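(* Assume the Generalized Riemann Hypothesis (GRH). Let $\chi$ be a primitive Dirichlet character of order $3$ and conductor $q$. Then, as $q\to\infty$, $$\left( \frac{1}{\sqrt{2}} + o(1) \right) \left(\frac{\zeta(3)}{e^{\gamma}\log_2 q}\right)^{1/2} \leq |L(1,\chi)| \leq \left( 2 + o(1) \right) e^\gamma \log_2 q.$$
   Context: $L(s,\chi)=\sum_{n\ge1}\chi(n)n^{-s}$ is the Dirichlet $L$-function, $\gamma$ is the Euler–Mascheroni constant, and $\log_j$ denotes the $j$-fold iterated logarithm (so $\log_2 q=\log\log q$). *)

theory Defs
  imports "HOL-Analysis.Analysis"
begin

definition dirichlet_char :: "nat \<Rightarrow> (nat \<Rightarrow> complex) \<Rightarrow> bool" where
  "dirichlet_char q chi \<longleftrightarrow> q > 0 \<and>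
     (\<forall>m n. chi (m * n) = chi m * chi n) \<and>
     (\<forall>n. chi (n + q) = chi n) \<and>
     (\<forall>n. chi n \<noteq> 0 \<longleftrightarrow> coprime n q)"

definition principal_char :: "nat \<Rightarrow> (nat \<Rightarrow> complex) \<Rightarrow> bool" where
  "principal_char q chi \<longleftrightarrow> (\<forall>n. chi n = (if coprime n q then 1 else 0))"

text \<open>Character of order exactly 3 (3 is prime, so chi^3 principal and chi nonprincipal).\<close>
definition char_order3 :: "nat \<Rightarrow> (nat \<Rightarrow> complex) \<Rightarrow> bool" where
  "char_order3 q chi \<longleftrightarrow> dirichlet_char q chi \<and> \<not> principal_char q chi \<and>
     (\<forall>n. chi n ^ 3 = (if coprime n q then 1 else 0))"

definition primitive_char :: "nat \<Rightarrow> (nat \<Rightarrow> complex) \<Rightarrow> bool" where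
  "primitive_char q chi \<longleftrightarrow> dirichlet_char q chi \<and>
     (\<forall>d. d dvd q \<and> d < q \<longrightarrow>
        \<not> (\<forall>m n. coprime m q \<and> coprime n q \<and> m mod d = n mod d \<longrightarrow> chi m = chi n))"

text \<open>Dirichlet series L(s,chi) = sum_{n>=1} chi(n) n^{-s} (n = 0 term is 0).\<close>
definition dirichlet_L :: "(nat \<Rightarrow> complex) \<Rightarrow> complex \<Rightarrow> complex" where
  "dirichlet_L chi s = (\<Sum>n. chi n / of_nat n powr s)"

text \<open>Dirichlet eta function, eta(s) = (1 - 2^{1-s}) zeta(s), convergent for Re s > 0.\<close>
definition dirichlet_eta :: "complex \<Rightarrow> complex" where
  "dirichlet_eta s = (\<Sum>n. (-1) ^ (n + 1) / of_nat n powr s)"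

text \<open>GRH: no zeros of zeta (via eta) and of L(s,chi) for nonprincipal chi in 1/2 < Re s < 1.\<close>
definition GRH :: bool where
  "GRH \<longleftrightarrow>
     (\<forall>s. 1/2 < Re s \<and> Re s < 1 \<longrightarrow> dirichlet_eta s \<noteq> 0) \<and>
     (\<forall>q chi s. dirichlet_char q chi \<and> \<not> principal_char q chi \<and> 1/2 < Re s \<and> Re s < 1
        \<longrightarrow> dirichlet_L chi s \<noteq> 0)"

definition zeta3 :: real where
  "zeta3 = (\<Sum>n. 1 / (real (Suc n)) ^ 3)"

end

theory Submission
  imports Defs "HOL-Complex_Analysis.Complex_Analysis" "HOL-Number_Theory.Prime_Powers"
    "HOL-Number_Theory.Cong" "HOL-Real_Asymp.Real_Asymp"
begin

text \<open>
  Write \<open>w(n) = \<Lambda>(n) / ln n\<close>, so that \<open>log L(s, \<chi>) = \<Sum> w(n) \<chi>(n) n\<^sup>-\<^sup>s\<close> for \<open>Re s > 1\<close>. Under GRH this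
  logarithm continues to \<open>Re s > 1/2\<close> and is \<open>O(log (q (|t| + 2)))\<close> there by Borel--Caratheodory.
  Let \<open>E(s)\<close> be its difference from the partial sum over \<open>n \<le> N\<close>. The maximum modulus principle for
  \<open>E(1 + z) N\<^sup>z exp(z\<^sup>2)\<close> on the strip \<open>-\<eta> \<le> Re z \<le> 1\<close>, with \<open>\<eta>\<close> slightly below \<open>1/2\<close>, combined with
  Chebyshev's bound on both edges, gives \<open>E(1) = o(1)\<close> as soon as \<open>N = (ln q)\<^sup>a\<close> with \<open>a > 2\<close>. It remains
  to bound \<open>Re \<Sum>\<^sub>n\<^sub>\<le>\<^sub>N w(n) \<chi>(n) / n\<close>: from above by \<open>\<Sum>\<^sub>n\<^sub>\<le>\<^sub>N w(n) / n = ln ln N + \<gamma> + o(1)\<close> (Mertens), and from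
  below by using \<open>Re \<chi> \<ge> -1/2\<close> together with \<open>\<chi>(m\<^sup>3) = 1\<close>, where the cubes produce \<open>ln \<zeta>(3)\<close>.
\<close>

section \<open>The logarithm of an Euler product\<close>

text \<open>The constants 2 and 1 / sqrt 2 both come from the length N of the sum. On the left edge
  the error is about N^-\<eta> ln q with \<eta> < 1/2, so N has to exceed (ln q)^2, and ln N is then
  about 2 ln ln q. The upper bound is exp \<gamma> * ln N, the lower one the square root of
  \<zeta>(3) / (exp \<gamma> * ln N). Uniformity in q requires that q enter only through ln q; for
  this the crude bound |L(s, \<chi>)| \<le> q (1 + 3 |s|) is good enough. The obstacle is that E(1)
  must be o(1) and not just O(1): bounding w by 1 gives only O(1) on either vertical edge, and the
  missing factor 1 / ln N is what Chebyshev's bound supplies. \<open>GRH\<close> speaks of the open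
  strip 1/2 < Re s < 1, so the line Re s = 1 is settled by the classical 3-4-1 argument. Mertens'
  constant is found by comparing Abel means of the prime power sum with those of the harmonic
  numbers; an upper estimate suffices, because both final bounds want this sum from above.\<close>

definition primepow_weight :: "nat \<Rightarrow> real" where
  "primepow_weight n = mangoldt n / ln (real n)"

lemma primepow_weight_nonneg: "primepow_weight n \<ge> 0"
  unfolding primepow_weight_def
  by (cases "n = 0") (auto intro!: divide_nonneg_nonneg mangoldt_nonneg)

lemma primepow_weight_le_1: "primepow_weight n \<le> 1"
proof (cases "n \<le> 1")
  case True
  then have "n = 0 \<or> n = 1" by auto
  then show ?thesis by (auto simp: primepow_weight_def)
next
  case False
  then show ?thesis
    using mangoldt_le[of n] by (auto simp: primepow_weight_def divide_le_eq)
qed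

lemma primepow_weight_1 [simp]: "primepow_weight (Suc 0) = 0" "primepow_weight 0 = 0"
  by (simp_all add: primepow_weight_def)

lemma primepow_weight_prime_power: "prime p \<Longrightarrow> primepow_weight (p ^ k) = 1 / real k"
proof (cases "k = 0")
  case False
  assume "prime p"
  then have "p > 1" by (rule prime_gt_1_nat)
  then show ?thesis using False \<open>prime p\<close> by (simp add: primepow_weight_def ln_realpow)
qed auto

lemma primepow_weight_eq_0: "\<not> primepow n \<Longrightarrow> primepow_weight n = 0"
  by (simp add: primepow_weight_def mangoldt_def)

lemma summable_primepow_weight:
  fixes f :: "nat \<Rightarrow> complex"
  assumes "summable (\<lambda>n. norm (f n))"
  shows "summable (\<lambda>n. norm (of_real (primepow_weight n) * f n))"
proof (rule summable_comparison_test')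
  show "norm (norm (of_real (primepow_weight n) * f n)) \<le> norm (f n)" for n
    using mult_right_mono[OF primepow_weight_le_1[of n], of "norm (f n)"]
    by (simp add: norm_mult primepow_weight_nonneg)
qed (use assms in auto)

text \<open>Stated for the exponential of the series, so that no branch of the logarithm is involved.\<close>

theorem exp_primepow_weight_series:
  fixes f :: "nat \<Rightarrow> complex"
  assumes f0: "f 0 = 0" and f1: "f 1 = 1" and mult: "\<And>m n. f (m * n) = f m * f n"
    and summ: "summable (\<lambda>n. norm (f n))"
  shows "exp (\<Sum>n. of_real (primepow_weight n) * f n) = (\<Sum>n. f n)"
proof -
  \<comment> \<open>Induction on a bound N for the primes: \<open>F N\<close> sums f over the
    numbers with all prime factors below N, and \<open>G N\<close>, over the powers of these primes,
    is its logarithm. A new prime p divides F by 1 - f p and adds the series of - Ln (1 - f p) to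
    G.\<close>
  define smooth where "smooth = (\<lambda>N n. n > 0 \<and> (\<forall>p. prime p \<and> p dvd n \<longrightarrow> p < (N::nat)))"
  define pp where "pp = (\<lambda>N n. \<exists>p k. prime p \<and> p < (N::nat) \<and> n = p ^ k)"
  define F where "F = (\<lambda>N. \<Sum>n. if smooth N n then f n else 0)"
  define w where "w = (\<lambda>n. complex_of_real (primepow_weight n) * f n)"
  define G where "G = (\<lambda>N. \<Sum>n. if pp N n then w n else 0)"
  have summw: "summable (\<lambda>n. norm (w n))"
    unfolding w_def by (rule summable_primepow_weight[OF summ])
  have sub: "summable (\<lambda>n. if P n then g n else 0)" if "summable (\<lambda>n. norm (g n))" for P and g :: "nat \<Rightarrow> complex"
    by (rule summable_comparison_test'[OF that, of 0]) auto
  have fpow: "f (m ^ k) = f m ^ k" for m k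
    by (induction k) (use f1 mult in auto)
  \<comment> \<open>Summability forces this: f (p^k) = (f p)^k tends to 0 along the powers of p. It
    makes 1 - f p nonzero and the logarithmic series convergent.\<close>
  have fp: "norm (f p) < 1" if "p \<ge> 2" for p
  proof -
    have "strict_mono (\<lambda>k. p ^ k)" using that by (auto intro!: strict_monoI power_strict_increasing)
    then have "(\<lambda>k. f (p ^ k)) \<longlonglongrightarrow> 0"
      using LIMSEQ_subseq_LIMSEQ[OF summable_LIMSEQ_zero[OF summable_norm_cancel[OF summ]]]
      by (auto simp: o_def)
    then have "(\<lambda>k. f p ^ k) \<longlonglongrightarrow> 0" by (simp add: fpow)
    then have lim: "(\<lambda>k. norm (f p) ^ k) \<longlonglongrightarrow> 0"
      using tendsto_norm_zero by (fastforce simp: norm_power)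
    show ?thesis
    proof (rule ccontr)
      assume "\<not> ?thesis"
      then have "(1::real) \<le> 0"
        by (intro tendsto_lowerbound[OF lim]) (auto intro!: always_eventually one_le_power)
      then show False by simp
    qed
  qed
  have eq: "exp (G N) = F N" for N
  proof (induction N)
    case 0
    have "smooth 0 n \<longleftrightarrow> n = 1" for n
      unfolding smooth_def using prime_factor_nat[of n] by (auto dest: prime_gt_0_nat)
    then have "F 0 = (\<Sum>n. if n = 1 then f n else 0)" unfolding F_def by simp
    also have "\<dots> = 1" using f1 by (subst suminf_finite[of "{1}"]) auto
    finally show ?case by (simp add: G_def pp_def)
  next
    case (Suc N)
    show ?case
    proof (cases "prime N")
      case False
      then have "smooth (Suc N) n = smooth N n" "pp (Suc N) n = pp N n" for n
        unfolding smooth_def pp_def by (metis less_Suc_eq)+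
      then show ?thesis using Suc by (simp add: F_def G_def)
    next
      case True
      then have N: "N \<ge> 2" by (rule prime_ge_2_nat)
      have "F (Suc N) = (\<Sum>n. (if smooth N n then f n else 0) + (if smooth (Suc N) n \<and> N dvd n then f n else 0))"
        unfolding F_def
      proof (intro arg_cong[of _ _ suminf] ext)
        fix n
        have "smooth (Suc N) n \<and> \<not> N dvd n \<longleftrightarrow> smooth N n"
          unfolding smooth_def using True less_Suc_eq by auto
        then show "(if smooth (Suc N) n then f n else 0) =
          (if smooth N n then f n else 0) + (if smooth (Suc N) n \<and> N dvd n then f n else 0)"
          by auto
      qed
      also have "\<dots> = F N + (\<Sum>n. if smooth (Suc N) n \<and> N dvd n then f n else 0)"
        unfolding F_def by (intro suminf_add[symmetric] sub summ)
      \<comment> \<open>The multiples of N among the numbers with all prime factors at most N are N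
        times an arbitrary such number, so F (N + 1) = F N + f N * F (N + 1).\<close>
      also have "(\<Sum>n. if smooth (Suc N) n \<and> N dvd n then f n else 0)
          = (\<Sum>m. if smooth (Suc N) (N * m) \<and> N dvd (N * m) then f (N * m) else 0)"
        using N by (intro suminf_mono_reindex[symmetric, of "\<lambda>m. N * m"])
          (auto intro!: strict_monoI elim!: dvdE)
      also have "\<dots> = (\<Sum>m. f N * (if smooth (Suc N) m then f m else 0))"
      proof (intro arg_cong[of _ _ suminf] ext)
        fix m
        have "smooth (Suc N) (N * m) \<longleftrightarrow> smooth (Suc N) m"
          unfolding smooth_def using True N
          by (auto simp: prime_dvd_mult_iff dest: primes_dvd_imp_eq)
        then show "(if smooth (Suc N) (N * m) \<and> N dvd (N * m) then f (N * m) else 0)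
            = f N * (if smooth (Suc N) m then f m else 0)"
          by (simp add: mult)
      qed
      also have "\<dots> = f N * F (Suc N)"
        unfolding F_def by (intro suminf_mult sub summ)
      finally have F: "F (Suc N) * (1 - f N) = F N" by (simp add: algebra_simps)
      have fN: "1 - f N \<noteq> 0" using fp[OF N] by auto
      have "G (Suc N) = (\<Sum>n. (if pp N n then w n else 0) + (if n \<in> range (\<lambda>k. N ^ k) then w n else 0))"
        unfolding G_def
      proof (intro arg_cong[of _ _ suminf] ext)
        fix n
        \<comment> \<open>\<open>pp\<close> admits the exponent 0, so the two sets can share only n
          = 1, where the weight vanishes.\<close>
        have "w n = 0" if "pp N n" "n \<in> range (\<lambda>k. N ^ k)"
        proof -
          from that obtain p k j where *: "prime p" "p < N" "n = p ^ k" "n = N ^ j"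
            unfolding pp_def by auto
          have "j = 0"
          proof (rule ccontr)
            assume "j \<noteq> 0"
            then have "N dvd p ^ k" using * dvd_power[of j N] by (metis neq0_conv)
            then have "N dvd p" using True prime_dvd_power by blast
            then show False using * True primes_dvd_imp_eq by blast
          qed
          then have "n = 1" using * by simp
          then show ?thesis by (simp add: w_def)
        qed
        moreover have "pp (Suc N) n \<longleftrightarrow> pp N n \<or> n \<in> range (\<lambda>k. N ^ k)"
          unfolding pp_def using True by (auto simp: less_Suc_eq)
        ultimately show "(if pp (Suc N) n then w n else 0) =
            (if pp N n then w n else 0) + (if n \<in> range (\<lambda>k. N ^ k) then w n else 0)"
          by auto
      qed
      also have "\<dots> = G N + (\<Sum>n. if n \<in> range (\<lambda>k. N ^ k) then w n else 0)"
        unfolding G_def by (intro suminf_add[symmetric] sub summw)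
      also have "(\<Sum>n. if n \<in> range (\<lambda>k. N ^ k) then w n else 0)
          = (\<Sum>k. if N ^ k \<in> range (\<lambda>k. N ^ k) then w (N ^ k) else 0)"
        using N by (intro suminf_mono_reindex[symmetric, of "\<lambda>k. N ^ k"])
          (auto intro!: strict_monoI power_strict_increasing)
      \<comment> \<open>At k = 0 both summands vanish, since \<open>w 1 = 0\<close> and division by
        zero gives 0.\<close>
      also have "\<dots> = (\<Sum>k. f N ^ k / of_nat k)"
        using True by (simp add: w_def primepow_weight_prime_power fpow)
      also have "\<dots> = - Ln (1 - f N)"
        using sums_minus[OF Ln_series'[of "- f N"]] fp[OF N] by (simp add: sums_iff)
      finally have "exp (G (Suc N)) = exp (G N) / (1 - f N)"
        using fN by (simp add: exp_diff)
      then show ?thesis using F fN Suc by (simp add: nonzero_divide_eq_eq)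
    qed
  qed
  have limF: "F \<longlonglongrightarrow> (\<Sum>n. f n)"
    unfolding F_def
  proof (rule tannerys_theorem[THEN conjunct2, THEN conjunct2])
    fix n
    show "(\<lambda>N. if smooth N n then f n else 0) \<longlonglongrightarrow> f n"
    proof (rule tendsto_eventually)
      show "eventually (\<lambda>N. (if smooth N n then f n else 0) = f n) sequentially"
        using eventually_gt_at_top[of n]
      proof eventually_elim
        case (elim N)
        then show ?case
          by (cases "n = 0") (auto simp: smooth_def f0 dest!: dvd_imp_le)
      qed
    qed
  qed (use summ in \<open>auto intro!: always_eventually\<close>)
  have "G \<longlonglongrightarrow> (\<Sum>n. w n)"
    unfolding G_def
  proof (rule tannerys_theorem[THEN conjunct2, THEN conjunct2])
    fix n
    show "(\<lambda>N. if pp N n then w n else 0) \<longlonglongrightarrow> w n"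
    proof (rule tendsto_eventually)
      show "eventually (\<lambda>N. (if pp N n then w n else 0) = w n) sequentially"
        using eventually_gt_at_top[of n]
      proof eventually_elim
        case (elim N)
        show ?case
        proof (cases "primepow n")
          case True
          then obtain p k where p: "prime p" "k > 0" "n = p ^ k"
            unfolding primepow_def by auto
          then have "p \<le> n" using prime_ge_1_nat[OF p(1)] self_le_power[of p k] by simp
          then have "pp N n" unfolding pp_def using p elim by auto
          then show ?thesis by simp
        qed (simp add: w_def primepow_weight_eq_0)
      qed
    qed
  qed (use summw in \<open>auto intro!: always_eventually\<close>)
  from tendsto_exp[OF this] have "F \<longlonglongrightarrow> exp (\<Sum>n. w n)" by (simp add: eq)
  from LIMSEQ_unique[OF this limF] show ?thesis by (simp add: w_def)
qed

section \<open>Chebyshev and Mertens estimates\<close>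

text \<open>Legendre's formula. Passing from n to n + 1 raises \<open>n div d\<close> exactly at the
  divisors d of n + 1, and \<Lambda> summed over these is ln (n + 1).\<close>

lemma ln_fact_eq_sum_mangoldt:
  "ln (fact n) = (\<Sum>d\<le>n. mangoldt d * real (n div d))"
proof (induction n)
  case (Suc n)
  have "(\<Sum>d\<le>Suc n. mangoldt d * real (Suc n div d))
      = (\<Sum>d\<le>Suc n. mangoldt d * real (n div d)) + (\<Sum>d\<le>Suc n. if d dvd Suc n then mangoldt d else 0)"
    unfolding sum.distrib [symmetric]
  proof (intro sum.cong refl)
    fix d :: nat
    have "Suc n div d = n div d + (if d dvd Suc n then 1 else 0)"
      unfolding div_Suc dvd_eq_mod_eq_0 by simp
    then show "mangoldt d * real (Suc n div d) = mangoldt d * real (n div d) + (if d dvd Suc n then mangoldt d else 0)"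
      by (cases "d dvd Suc n") (simp_all add: distrib_left)
  qed
  also have "(\<Sum>d\<le>Suc n. if d dvd Suc n then mangoldt d else 0) = (\<Sum>d | d dvd Suc n. mangoldt d :: real)"
    by (intro sum.mono_neutral_cong_right) (auto dest: dvd_imp_le)
  also have "\<dots> = ln (real (Suc n))"
    by (subst mangoldt_sum) auto
  also have "(\<Sum>d\<le>Suc n. mangoldt d * real (n div d)) = (\<Sum>d\<le>n. mangoldt d * real (n div d))"
    by simp
  finally show ?case
    using Suc by (simp add: ln_mult)
qed auto

text \<open>Chebyshev's argument: in the logarithm of the central binomial coefficient, \<Lambda>(d)
  is multiplied by \<open>2*n div d - 2 * (n div d)\<close>, which is never negative and is 1 for n
  < d \<le> 2n, while the binomial coefficient is at most \<open>2 ^ (2*n)\<close>.\<close>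

lemma sum_mangoldt_double_le:
  "(\<Sum>d\<le>2*n. mangoldt d :: real) \<le> (\<Sum>d\<le>n. mangoldt d) + 2 * real n * ln 2"
proof -
  have "(\<Sum>d\<in>{n<..2*n}. mangoldt d :: real) \<le> (\<Sum>d\<le>2*n. mangoldt d * (real (2*n div d) - 2 * real (n div d)))"
  proof (rule order.trans)
    show "(\<Sum>d\<in>{n<..2*n}. mangoldt d :: real) \<le> (\<Sum>d\<in>{n<..2*n}. mangoldt d * (real (2*n div d) - 2 * real (n div d)))"
    proof (intro sum_mono)
      fix d assume d: "d \<in> {n<..2*n}"
      then have "2*n div d \<ge> 1" "n div d = 0"
        by (auto simp: div_greater_zero_iff Suc_le_eq)
      then show "mangoldt d \<le> mangoldt d * (real (2*n div d) - 2 * real (n div d))"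
        using mangoldt_nonneg[of d] by (simp add: mult_le_cancel_left1)
    qed
    have "real (2*n div d) - 2 * real (n div d) \<ge> 0" for d
    proof -
      have "2 * (n div d) \<le> 2 * n div d"
        by (cases "d = 0") (auto simp: less_eq_div_iff_mult_less_eq algebra_simps)
      then show ?thesis by linarith
    qed
    then show "(\<Sum>d\<in>{n<..2*n}. mangoldt d * (real (2*n div d) - 2 * real (n div d)))
        \<le> (\<Sum>d\<le>2*n. mangoldt d * (real (2*n div d) - 2 * real (n div d)))"
      by (intro sum_mono2) (auto intro!: mult_nonneg_nonneg mangoldt_nonneg)
  qed
  also have "\<dots> = ln (fact (2*n)) - 2 * (\<Sum>d\<le>2*n. mangoldt d * real (n div d))"
    unfolding ln_fact_eq_sum_mangoldt by (simp add: sum_subtractf sum_distrib_left algebra_simps)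
  also have "(\<Sum>d\<le>2*n. mangoldt d * real (n div d)) = (\<Sum>d\<le>n. mangoldt d * real (n div d))"
    by (intro sum.mono_neutral_right) auto
  also have "\<dots> = ln (fact n)" by (simp add: ln_fact_eq_sum_mangoldt)
  also have "ln (fact (2*n)) - 2 * ln (fact n) = ln (real ((2*n) choose n))"
    by (simp add: binomial_fact ln_div ln_mult)
  also have "\<dots> \<le> ln (2 ^ (2*n))"
  proof -
    have "real ((2*n) choose n) \<le> real (2 ^ (2*n))"
      using binomial_le_pow2[of "2*n" n] by (subst of_nat_le_iff)
    moreover have "real ((2*n) choose n) > 0" by (simp add: zero_less_binomial)
    ultimately show ?thesis by simp
  qed
  also have "\<dots> = 2 * real n * ln 2" by (simp add: ln_realpow)
  finally have "(\<Sum>d\<in>{n<..2*n}. mangoldt d :: real) \<le> 2 * real n * ln 2" .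
  moreover have "(\<Sum>d\<le>2*n. mangoldt d :: real) = (\<Sum>d\<le>n. mangoldt d) + (\<Sum>d\<in>{n<..2*n}. mangoldt d)"
    by (subst sum.union_disjoint [symmetric]) (auto intro!: sum.cong)
  ultimately show ?thesis by simp
qed

lemma sum_mangoldt_le: "(\<Sum>d\<le>n. mangoldt d :: real) \<le> 4 * real n"
proof (induction n rule: less_induct)
  case (less n)
  show ?case
  proof (cases "n \<le> 1")
    case True
    then have "n = 0 \<or> n = 1" by auto
    then show ?thesis by auto
  next
    case False
    define m where "m = (n + 1) div 2"
    have m: "m < n" "n \<le> 2 * m" "2 * m \<le> n + 1" "m \<ge> 1" using False unfolding m_def by auto
    have "(\<Sum>d\<le>n. mangoldt d :: real) \<le> (\<Sum>d\<le>2*m. mangoldt d)"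
      using m by (intro sum_mono2) (auto simp: mangoldt_nonneg)
    also have "\<dots> \<le> (\<Sum>d\<le>m. mangoldt d) + 2 * real m * ln 2" by (rule sum_mangoldt_double_le)
    also have "\<dots> \<le> 4 * real m + 2 * real m * ln 2" using less[OF m(1)] by simp
    also have "2 * real m * ln 2 \<le> 2 * real m * 1"
      using ln_2_less_1 by (intro mult_left_mono) auto
    also have "4 * real m + 2 * real m * 1 \<le> 4 * real n"
    proof -
      \<comment> \<open>Twice \<open>2 * m \<le> n + 1\<close> plus twice \<open>m < n\<close>; this
        is where the constant 4 closes the induction.\<close>
      have "6 * m \<le> 4 * n" using m False by linarith
      then show ?thesis by linarith
    qed
    finally show ?thesis by simp
  qed
qed

text \<open>Mertens' first theorem. Removing the floors in Legendre's formula costs at most the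
  Chebyshev sum, which is at most 4n, and ln n! lies between n ln n - n and n ln n.\<close>

lemma sum_mangoldt_over_bounds:
  assumes "n \<ge> 1"
  shows "\<bar>(\<Sum>d\<le>n. mangoldt d / real d) - ln (real n)\<bar> \<le> 4"
proof -
  have up: "ln (fact n) \<le> real n * (\<Sum>d\<le>n. mangoldt d / real d)"
    unfolding ln_fact_eq_sum_mangoldt sum_distrib_left
  proof (intro sum_mono)
    fix d
    have "real (n div d) \<le> real n / real d" by (rule of_nat_div_le_of_nat)
    then have "mangoldt d * real (n div d) \<le> mangoldt d * (real n / real d)"
      by (intro mult_left_mono) (auto simp: mangoldt_nonneg)
    then show "mangoldt d * real (n div d) \<le> real n * (mangoldt d / real d)"
      by (simp add: mult_ac)
  qed
  have lo: "real n * (\<Sum>d\<le>n. mangoldt d / real d) \<le> ln (fact n) + (\<Sum>d\<le>n. mangoldt d)"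
    unfolding ln_fact_eq_sum_mangoldt sum_distrib_left sum.distrib [symmetric]
  proof (intro sum_mono)
    fix d
    have "real n / real d \<le> real (n div d) + 1"
      using mod_less_divisor[of d n] 
      by (cases "d = 0") (auto simp: of_nat_of_nat_div_aux[of n d] divide_le_eq_1 less_imp_le)
    then have "mangoldt d * (real n / real d) \<le> mangoldt d * (real (n div d) + 1)"
      by (intro mult_left_mono) (auto simp: mangoldt_nonneg)
    then show "real n * (mangoldt d / real d) \<le> mangoldt d * real (n div d) + mangoldt d"
      by (simp add: algebra_simps)
  qed
  have f1: "ln (fact n) \<le> real n * ln (real n)"
  proof -
    have "(fact n :: real) \<le> real n ^ n"
      using fact_le_power[of n, where 'a = real] by simp
    then have "ln (fact n) \<le> ln (real n ^ n)" using assms by (subst ln_le_cancel_iff) auto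
    then show ?thesis using assms by (simp add: ln_realpow)
  qed
  have f2: "ln (fact n) \<ge> real n * ln (real n) - real n"
  proof -
    \<comment> \<open>One term of the exponential series takes the place of Stirling's
      formula.\<close>
    have "real n ^ n / fact n \<le> exp (real n)"
    proof -
      have "(\<Sum>k\<in>{n}. inverse (fact k) *\<^sub>R real n ^ k) \<le> exp (real n)"
        unfolding exp_def by (intro sum_le_suminf) (auto intro: summable_exp)
      then show ?thesis by (simp add: field_simps)
    qed
    then have "ln (real n ^ n / fact n) \<le> ln (exp (real n))"
      using assms by (subst ln_le_cancel_iff) auto
    then show ?thesis using assms by (simp add: ln_div ln_realpow)
  qed
  have "real n * (\<Sum>d\<le>n. mangoldt d / real d) \<le> real n * (ln (real n) + 4)"
    using lo f1 sum_mangoldt_le[of n] by (simp add: algebra_simps)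
  moreover have "real n * (ln (real n) - 1) \<le> real n * (\<Sum>d\<le>n. mangoldt d / real d)"
    using up f2 by (simp add: algebra_simps)
  ultimately show ?thesis using assms by (simp add: abs_le_iff)
qed

section \<open>Partial summation and the existence of Mertens' limit\<close>

lemma summation_by_parts:
  fixes a b :: "nat \<Rightarrow> 'a::comm_ring"
  shows "(\<Sum>k<n. a k * b k) = (\<Sum>k<n. (\<Sum>j\<le>k. a j) * (b k - b (Suc k))) + (\<Sum>j<n. a j) * b n"
  by (induction n) (auto simp: algebra_simps lessThan_Suc_atMost[symmetric])

text \<open>The factor b will also be n^-s with complex s, so bounded variation replaces
  monotonicity. The quantitative half yields the later bound for L(s, \<chi>).\<close>

lemma Dirichlet_test:
  fixes a b :: "nat \<Rightarrow> 'a::{real_normed_field, banach}"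
  assumes B: "\<And>n. norm (\<Sum>j\<le>n. a j) \<le> B" and b: "b \<longlonglongrightarrow> 0"
    and s: "summable (\<lambda>n. norm (b n - b (Suc n)))"
  shows "(\<lambda>n. a n * b n) sums (\<Sum>n. (\<Sum>j\<le>n. a j) * (b n - b (Suc n)))"
    and "norm (\<Sum>n. a n * b n) \<le> B * (\<Sum>n. norm (b n - b (Suc n)))"
proof -
  let ?c = "\<lambda>n. (\<Sum>j\<le>n. a j) * (b n - b (Suc n))"
  have le: "norm (?c n) \<le> B * norm (b n - b (Suc n))" for n
    by (simp add: norm_mult mult_right_mono[OF B])
  have sc: "summable (\<lambda>n. norm (?c n))"
    by (rule summable_comparison_test'[OF summable_mult[OF s, of B], of 0]) (use le in auto)
  have "norm (\<Sum>j<n. a j) \<le> B" for n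
  proof (cases n)
    case 0
    then show ?thesis using order.trans[OF norm_ge_zero B[of 0]] by simp
  next
    case (Suc m)
    then show ?thesis using B[of m] by (simp add: lessThan_Suc_atMost)
  qed
  then have *: "\<forall>n. norm ((\<Sum>j<n. a j) * b n) \<le> B * norm (b n)"
    by (simp add: norm_mult mult_right_mono)
  have "(\<lambda>n. B * norm (b n)) \<longlonglongrightarrow> 0"
    using tendsto_mult_left[OF tendsto_norm_zero[OF b], of B] by simp
  then have "(\<lambda>n. (\<Sum>j<n. a j) * b n) \<longlonglongrightarrow> 0"
    by (rule Lim_null_comparison[OF always_eventually[OF *]])
  from tendsto_add[OF summable_LIMSEQ[OF summable_norm_cancel[OF sc]] this]
  show *: "(\<lambda>n. a n * b n) sums (\<Sum>n. ?c n)"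
    unfolding sums_def summation_by_parts[of a b] by simp
  have "norm (\<Sum>n. ?c n) \<le> (\<Sum>n. norm (?c n))" by (rule summable_norm[OF sc])
  also have "\<dots> \<le> (\<Sum>n. B * norm (b n - b (Suc n)))"
    by (rule suminf_le[OF le sc summable_mult[OF s]])
  also have "\<dots> = B * (\<Sum>n. norm (b n - b (Suc n)))" by (rule suminf_mult[OF s])
  finally show "norm (\<Sum>n. a n * b n) \<le> B * (\<Sum>n. norm (b n - b (Suc n)))"
    using * by (simp add: sums_iff)
qed

definition primepow_harm :: "nat \<Rightarrow> real" where
  "primepow_harm n = (\<Sum>d\<le>n. primepow_weight d / real d)"

text \<open>Split \<Lambda>(n) = (\<Lambda>(n) - 1) + 1 in \<Lambda>(n) / (n ln n). The first part
  converges by Dirichlet's test, since (\<Lambda>(n) - 1) / n has bounded partial sums by Mertens'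
  first theorem; the second is ln ln n up to a convergent sequence, by comparison with the integral.
  The value of the limit stays open here.\<close>

lemma convergent_primepow_harm: "convergent (\<lambda>n. primepow_harm n - ln (ln (real n)))"
proof -
  define a where "a = (\<lambda>n::nat. (mangoldt (n + 2) - 1) / real (n + 2) :: real)"
  define b where "b = (\<lambda>n::nat. 1 / ln (real (n + 2)))"
  have decr: "b (Suc n) \<le> b n" for n
    unfolding b_def by (intro divide_left_mono mult_pos_pos) auto
  have b0: "b \<longlonglongrightarrow> 0" unfolding b_def by real_asymp
  have sum_a: "(\<Sum>j\<le>n. a j) = (\<Sum>d\<le>n+2. mangoldt d / real d) - harm (n + 2) + 1" for n
  proof (induction n)
    case 0
    show ?case by (simp add: a_def harm_Suc harm_def[of 0] numeral_2_eq_2 field_simps)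
  next
    case (Suc n)
    have "(\<Sum>d\<le>Suc n + 2. mangoldt d / real d) = (\<Sum>d\<le>n + 2. mangoldt d / real d) + mangoldt (Suc n + 2) / real (Suc n + 2)"
      by simp
    moreover have "harm (Suc n + 2) = harm (n + 2) + 1 / real (Suc n + 2)"
      using harm_Suc[of "n + 2", where 'a = real] by (simp add: inverse_eq_divide)
    ultimately show ?case using Suc by (simp add: a_def diff_divide_distrib del: of_nat_Suc of_nat_add)
  qed
  \<comment> \<open>6 covers 4 from Mertens' first theorem, 1 from the harmonic numbers and 1 from
    the omitted term at n = 1.\<close>
  have bound: "norm (\<Sum>j\<le>n. a j) \<le> 6" for n
  proof -
    have "harm (n + 2) - ln (real (n + 2)) \<ge> 0" "harm (n + 2) - ln (real (n + 2)) \<le> 1"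
      using euler_mascheroni_sequence_nonneg[of "n + 2"]
        euler_mascheroni_sequence_decreasing[of 1 "n + 2"] by (auto simp: harm_expand)
    then show ?thesis
      using sum_mangoldt_over_bounds[of "n + 2"] unfolding sum_a by simp
  qed
  have "summable (\<lambda>n. a n * b n)"
  proof (rule sums_summable[OF Dirichlet_test(1)[OF bound b0]])
    show "summable (\<lambda>n. norm (b n - b (Suc n)))"
      using telescope_summable'[OF b0] decr by simp
  qed
  then have c1: "convergent (\<lambda>n. \<Sum>j\<le>n. a j * b j)"
    by (simp add: summable_iff_convergent')
  interpret antimono_fun_sum_integral_diff "\<lambda>x. 1 / ((x + 2) * ln (x + 2))"
  proof
    show "1 / ((y + 2) * ln (y + 2)) \<le> 1 / ((x + 2) * ln (x + 2))" if "0 \<le> x" "x \<le> y" for x y :: real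
      using that by (intro divide_left_mono mult_mono mult_pos_pos) auto
  qed (auto intro!: continuous_intros)
  have int: "integral {0..real n} (\<lambda>x. 1 / ((x + 2) * ln (x + 2))) = ln (ln (real n + 2)) - ln (ln 2)" for n
  proof (rule integral_unique)
    have "((\<lambda>x. 1 / ((x + 2) * ln (x + 2))) has_integral ln (ln (real n + 2)) - ln (ln (0 + 2))) {0..real n}"
    proof (rule fundamental_theorem_of_calculus)
      fix x assume "x \<in> {0..real n}"
      then show "((\<lambda>x. ln (ln (x + 2))) has_vector_derivative 1 / ((x + 2) * ln (x + 2))) (at x within {0..real n})"
        unfolding has_real_derivative_iff_has_vector_derivative [symmetric]
        by (auto intro!: derivative_eq_intros simp: field_simps)
    qed auto
    then show "((\<lambda>x. 1 / ((x + 2) * ln (x + 2))) has_integral ln (ln (real n + 2)) - ln (ln 2)) {0..real n}" by simp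
  qed
  have "primepow_harm (n + 2) - ln (ln (real (n + 2))) =
      (\<Sum>j\<le>n. a j * b j) + sum_integral_diff_series n - ln (ln 2)" for n
  proof -
    have "primepow_harm (n + 2) = (\<Sum>j\<le>n. mangoldt (j + 2) / ((real j + 2) * ln (real j + 2)))"
    proof (induction n)
      case 0
      show ?case by (simp add: primepow_harm_def primepow_weight_def numeral_2_eq_2)
    next
      case (Suc n)
      have "primepow_harm (Suc n + 2) = primepow_harm (n + 2) + primepow_weight (Suc n + 2) / real (Suc n + 2)"
        by (simp add: primepow_harm_def)
      then show ?case using Suc by (simp add: primepow_weight_def add_ac mult_ac)
    qed
    also have "\<dots> = (\<Sum>j\<le>n. a j * b j) + (\<Sum>j\<le>n. 1 / ((real j + 2) * ln (real j + 2)))"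
      unfolding sum.distrib [symmetric]
      by (intro sum.cong) (auto simp: a_def b_def diff_divide_distrib add_ac)
    finally show ?thesis
      unfolding sum_integral_diff_series_def int by (simp add: algebra_simps)
  qed
  moreover have "convergent (\<lambda>n. (\<Sum>j\<le>n. a j * b j) + sum_integral_diff_series n - ln (ln 2))"
    by (intro convergent_diff convergent_add c1 sum_integral_diff_series_convergent convergent_const)
  ultimately have "convergent (\<lambda>n. primepow_harm (n + 2) - ln (ln (real (n + 2))))" by simp
  then show ?thesis
    using convergent_ignore_initial_segment[of "\<lambda>n. primepow_harm n - ln (ln (real n))" 2] by simp
qed

section \<open>Mertens' theorem with its constant\<close>

text \<open>The sign of s is free: s > 0 serves the tails of zeta series, and s = -\<eta> the
  growing partial sums of n powr (\<eta> - 1).\<close>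

lemma powr_neg_diff:
  fixes x s :: real
  assumes "x > 0"
  obtains z where "x < z" "z < x + 1" "x powr (-s) - (x + 1) powr (-s) = s * z powr (-s - 1)"
proof -
  have "\<exists>z>x. z < x + 1 \<and> (x + 1) powr (-s) - x powr (-s) = (x + 1 - x) * (- s * z powr (-s - 1))"
    using assms by (intro MVT2[of x "x + 1" "\<lambda>x. x powr (-s)" "\<lambda>z. - s * z powr (-s - 1)"])
      (auto intro!: derivative_eq_intros)
  then show ?thesis using that by (auto simp: algebra_simps)
qed

lemma powr_tail_le:
  assumes "\<sigma> > 0" "N \<ge> 1"
  shows "summable (\<lambda>n. real (n + Suc N) powr (-(1 + \<sigma>)))"
    and "(\<Sum>n. real (n + Suc N) powr (-(1 + \<sigma>))) \<le> real N powr (-\<sigma>) / \<sigma>"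
proof -
  have "summable (\<lambda>n. real n powr (-(1 + \<sigma>)))"
    using assms by (subst summable_real_powr_iff) auto
  then show s: "summable (\<lambda>n. real (n + Suc N) powr (-(1 + \<sigma>)))"
    by (subst summable_iff_shift)
  have "(\<lambda>n. real (n + N) powr (-\<sigma>)) \<longlonglongrightarrow> 0"
    using assms by real_asymp
  from sums_divide[OF telescope_sums'[OF this], of \<sigma>]
  have t: "(\<lambda>n. (real (n + N) powr (-\<sigma>) - real (Suc n + N) powr (-\<sigma>)) / \<sigma>) sums (real N powr (-\<sigma>) / \<sigma>)"
    by simp
  show "(\<Sum>n. real (n + Suc N) powr (-(1 + \<sigma>))) \<le> real N powr (-\<sigma>) / \<sigma>"
  proof (rule order.trans[OF suminf_le[OF _ s sums_summable[OF t]]])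
    fix n
    obtain z where z: "real (n + N) < z" "z < real (n + N) + 1"
      "real (n + N) powr (-\<sigma>) - (real (n + N) + 1) powr (-\<sigma>) = \<sigma> * z powr (-\<sigma> - 1)"
      using powr_neg_diff[of "real (n + N)" \<sigma>] assms by auto
    have "real (n + Suc N) powr (-\<sigma> - 1) \<le> z powr (-\<sigma> - 1)"
      using z assms by (intro powr_mono2') auto
    moreover have "z powr (-\<sigma> - 1) = (real (n + N) powr (-\<sigma>) - real (Suc n + N) powr (-\<sigma>)) / \<sigma>"
      using z(3) assms by (simp add: field_simps add_ac)
    moreover have "-(1 + \<sigma>) = -\<sigma> - 1" by simp
    ultimately show "real (n + Suc N) powr (-(1 + \<sigma>)) \<le> (real (n + N) powr (-\<sigma>) - real (Suc n + N) powr (-\<sigma>)) / \<sigma>"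
      by metis
  qed (use t in \<open>auto simp: sums_iff\<close>)
qed

lemma zeta_real_le:
  assumes "\<sigma> > 0"
  shows "summable (\<lambda>n. real n powr (-(1 + \<sigma>)))" "(\<Sum>n. real n powr (-(1 + \<sigma>))) \<le> 1 + 1 / \<sigma>"
proof -
  show s: "summable (\<lambda>n. real n powr (-(1 + \<sigma>)))"
    using assms by (subst summable_real_powr_iff) auto
  show "(\<Sum>n. real n powr (-(1 + \<sigma>))) \<le> 1 + 1 / \<sigma>"
    using suminf_split_initial_segment[OF s, of 2] powr_tail_le(2)[OF assms, of 1]
    by (simp add: numeral_2_eq_2)
qed

lemma exp_primepow_weight_series_real:
  fixes f :: "nat \<Rightarrow> real"
  assumes f0: "f 0 = 0" and f1: "f 1 = 1" and mult: "\<And>m n. f (m * n) = f m * f n"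
    and summ: "summable (\<lambda>n. \<bar>f n\<bar>)"
  shows "exp (\<Sum>n. primepow_weight n * f n) = (\<Sum>n. f n)"
proof -
  have "summable (\<lambda>n. norm (complex_of_real (primepow_weight n) * complex_of_real (f n)))"
    by (rule summable_primepow_weight) (use summ in simp)
  then have "summable (\<lambda>n. \<bar>primepow_weight n * f n\<bar>)" by (simp add: norm_mult abs_mult)
  then have s: "summable (\<lambda>n. primepow_weight n * f n)" by (rule summable_rabs_cancel)
  have "exp (\<Sum>n. of_real (primepow_weight n) * complex_of_real (f n)) = (\<Sum>n. complex_of_real (f n))"
    by (rule exp_primepow_weight_series) (use assms in auto)
  also have "(\<Sum>n. of_real (primepow_weight n) * complex_of_real (f n)) = of_real (\<Sum>n. primepow_weight n * f n)"
    by (subst suminf_of_real[OF s]) simp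
  also have "(\<Sum>n. complex_of_real (f n)) = of_real (\<Sum>n. f n)"
    by (rule suminf_of_real[symmetric]) (rule summable_rabs_cancel[OF summ])
  finally show ?thesis by (simp only: exp_of_real of_real_eq_iff)
qed

text \<open>The full series is ln \<zeta>(1 + \<sigma>), and \<zeta>(1 + \<sigma>) \<le> 1 + 1 /
  \<sigma>. As the pole has residue 1, nothing is lost in the limit \<sigma> to 0, where Mertens'
  constant is read off.\<close>

lemma sum_primepow_weight_powr_le:
  assumes "\<sigma> > 0" "finite A"
  shows "(\<Sum>n\<in>A. primepow_weight n * real n powr (-(1 + \<sigma>))) \<le> ln (1 + 1 / \<sigma>)"
proof -
  note z = zeta_real_le[OF assms(1)]
  have e: "exp (\<Sum>n. primepow_weight n * real n powr (-(1 + \<sigma>))) = (\<Sum>n. real n powr (-(1 + \<sigma>)))"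
    by (rule exp_primepow_weight_series_real) (use z(1) in \<open>auto simp: powr_mult\<close>)
  have "summable (\<lambda>n. primepow_weight n * real n powr (-(1 + \<sigma>)))"
    by (rule summable_comparison_test'[OF z(1), of 0])
      (auto simp: abs_mult primepow_weight_nonneg intro!: mult_left_le_one_le primepow_weight_le_1)
  then have "(\<Sum>n\<in>A. primepow_weight n * real n powr (-(1 + \<sigma>))) \<le> (\<Sum>n. primepow_weight n * real n powr (-(1 + \<sigma>)))"
    by (intro sum_le_suminf assms) (auto simp: primepow_weight_nonneg)
  also have "\<dots> = ln (\<Sum>n. real n powr (-(1 + \<sigma>)))"
    using e by (metis ln_exp)
  also have "\<dots> \<le> ln (1 + 1 / \<sigma>)"
    using z(2) e assms by (metis exp_gt_zero ln_mono)
  finally show ?thesis .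
qed

text \<open>Serves to evaluate a limit already known to exist, because the Abel means are easier to
  estimate than the sequence.\<close>

lemma Abel_means_tendsto:
  fixes S :: "nat \<Rightarrow> real"
  assumes "S \<longlonglongrightarrow> c"
  shows "((\<lambda>r. (1 - r) * (\<Sum>m. S m * r ^ m)) \<longlongrightarrow> c) (at_left 1)"
proof (rule tendstoI)
  fix e :: real assume e: "e > 0"
  from LIMSEQ_D[OF assms, of "e / 2"] e obtain M where M: "\<And>m. m \<ge> M \<Longrightarrow> \<bar>S m - c\<bar> < e / 2"
    by (auto simp: real_norm_def)
  obtain B where B: "\<And>m. \<bar>S m\<bar> \<le> B"
    using convergent_imp_Bseq[OF convergentI[OF assms]] by (auto simp: Bseq_def)
  define K where "K = (\<Sum>m<M. \<bar>S m - c\<bar>)"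
  have "((\<lambda>r. (1 - r) * K) \<longlongrightarrow> (1 - 1) * K) (at_left 1)" by (intro tendsto_intros)
  then have "eventually (\<lambda>r. (1 - r) * K < e / 2) (at_left 1)"
    using e by (intro order_tendstoD(2)) auto
  moreover have "eventually (\<lambda>r. r \<in> {0<..<1::real}) (at_left 1)"
    by (rule eventually_at_left_real) auto
  ultimately show "eventually (\<lambda>r. dist ((1 - r) * (\<Sum>m. S m * r ^ m)) c < e) (at_left 1)"
  proof eventually_elim
    case (elim r)
    then have r: "0 < r" "r < 1" by auto
    have g: "summable (\<lambda>m. r ^ m)" "(\<Sum>m. r ^ m) = 1 / (1 - r)"
      using r by (auto intro!: summable_geometric suminf_geometric)
    have s1: "summable (\<lambda>m. S m * r ^ m)"
      by (rule summable_comparison_test'[OF summable_mult[OF g(1), of B], of 0])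
         (use r B in \<open>auto simp: abs_mult intro!: mult_right_mono\<close>)
    have "(\<Sum>m. S m * r ^ m) - (\<Sum>m. c * r ^ m) = (\<Sum>m. S m * r ^ m - c * r ^ m)"
      by (rule suminf_diff[OF s1 summable_mult[OF g(1)]])
    then have eq: "(\<Sum>m. S m * r ^ m) - c / (1 - r) = (\<Sum>m. (S m - c) * r ^ m)"
      by (simp add: suminf_mult[OF g(1)] g left_diff_distrib)
    have s2: "summable (\<lambda>m. \<bar>S m - c\<bar> * r ^ m)"
    proof (rule summable_comparison_test'[OF summable_mult[OF g(1), of "B + \<bar>c\<bar>"], of 0])
      show "norm (\<bar>S m - c\<bar> * r ^ m) \<le> (B + \<bar>c\<bar>) * r ^ m" for m
        using B[of m] r by (auto simp: abs_mult intro!: mult_right_mono)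
    qed
    have s3: "summable (\<lambda>m. if m < M then \<bar>S m - c\<bar> else 0)"
      by (rule summable_finite[of "{..<M}"]) auto
    have "\<bar>\<Sum>m. (S m - c) * r ^ m\<bar> \<le> (\<Sum>m. \<bar>S m - c\<bar> * r ^ m)"
      using summable_norm[of "\<lambda>m. (S m - c) * r ^ m"] s2 r by (simp add: abs_mult)
    also have "\<dots> \<le> (\<Sum>m. (if m < M then \<bar>S m - c\<bar> else 0) + e / 2 * r ^ m)"
    proof (rule suminf_le[OF _ s2 summable_add[OF s3 summable_mult[OF g(1)]]])
      fix m
      show "\<bar>S m - c\<bar> * r ^ m \<le> (if m < M then \<bar>S m - c\<bar> else 0) + e / 2 * r ^ m"
      proof (cases "m < M")
        case True
        have "\<bar>S m - c\<bar> * r ^ m \<le> \<bar>S m - c\<bar>" using r by (intro mult_right_le_one_le power_le_one) auto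
        then show ?thesis using True r e by (simp add: add_increasing2)
      next
        case False
        then show ?thesis using M[of m] r by (auto intro!: mult_right_mono)
      qed
    qed
    also have "\<dots> = K + e / 2 * (1 / (1 - r))"
      unfolding suminf_add[OF s3 summable_mult[OF g(1)], symmetric] suminf_mult[OF g(1)] g(2) K_def
      by (subst suminf_finite[of "{..<M}"]) auto
    finally have "(1 - r) * \<bar>\<Sum>m. (S m - c) * r ^ m\<bar> \<le> (1 - r) * (K + e / 2 * (1 / (1 - r)))"
      using r by (intro mult_left_mono) auto
    also have "\<dots> = (1 - r) * K + e / 2"
    proof -
      have *: "x * (K + h * (1 / x)) = x * K + h" if "x \<noteq> 0" for x h :: real
        using that by (simp add: distrib_left)
      show ?thesis by (rule *) (use r in simp)
    qed
    also have "\<dots> < e" using elim by simp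
    finally have "\<bar>(1 - r) * (\<Sum>m. (S m - c) * r ^ m)\<bar> < e" using r by (simp add: abs_mult)
    moreover have "(1 - r) * (\<Sum>m. (S m - c) * r ^ m) = (1 - r) * (\<Sum>m. S m * r ^ m) - c"
      using r by (simp add: eq[symmetric] right_diff_distrib)
    ultimately show ?case by (simp add: dist_real_def)
  qed
qed

text \<open>Sampled at the integer part of exp m, the main term ln ln N becomes ln m, the main term
  of the harmonic numbers.\<close>

lemma ln_ln_floor_exp_tendsto:
  "(\<lambda>m. ln (ln (real (nat \<lfloor>exp (real m)\<rfloor>))) - ln (real m)) \<longlonglongrightarrow> 0"
proof (rule tendsto_sandwich)
  show "(\<lambda>m. ln (ln (exp (real m) - 1)) - ln (real m)) \<longlonglongrightarrow> 0" by real_asymp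
  have *: "eventually (\<lambda>m. exp (real m) > 3) sequentially" by real_asymp
  show "eventually (\<lambda>m. ln (ln (exp (real m) - 1)) - ln (real m)
          \<le> ln (ln (real (nat \<lfloor>exp (real m)\<rfloor>))) - ln (real m)) sequentially"
    using *
  proof eventually_elim
    case (elim m)
    have le: "exp (real m) - 1 \<le> real (nat \<lfloor>exp (real m)\<rfloor>)" using elim by linarith
    have "ln (exp (real m) - 1) \<le> ln (real (nat \<lfloor>exp (real m)\<rfloor>))"
      using elim by (intro ln_mono le) linarith
    moreover have "ln (exp (real m) - 1) > 0"
      using elim by (intro ln_gt_zero) linarith
    ultimately have "ln (ln (exp (real m) - 1)) \<le> ln (ln (real (nat \<lfloor>exp (real m)\<rfloor>)))"
      by (rule ln_mono)
    then show ?case by simp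
  qed
  show "eventually (\<lambda>m. ln (ln (real (nat \<lfloor>exp (real m)\<rfloor>))) - ln (real m) \<le> 0) sequentially"
    using *
  proof eventually_elim
    case (elim m)
    have "ln (real (nat \<lfloor>exp (real m)\<rfloor>)) \<le> ln (exp (real m))"
      using elim by (intro ln_mono) linarith+
    moreover have "ln (real (nat \<lfloor>exp (real m)\<rfloor>)) > 0"
      using elim by (intro ln_gt_zero) linarith+
    ultimately have "ln (ln (real (nat \<lfloor>exp (real m)\<rfloor>))) \<le> ln (ln (exp (real m)))"
      by (rule ln_mono)
    then show ?case by simp
  qed
qed auto

text \<open>The comparison that brings in \<gamma>. For n \<le> exp m one has r^m = exp (-\<sigma>
  m) \<le> n powr (-\<sigma>), so the Abel mean of the prime power sums sampled at exp m is at most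
  the sum of w(n) n^(-1-\<sigma>), hence at most ln (1 + 1 / \<sigma>). The Abel mean of the
  harmonic numbers is exactly - ln (1 - r).\<close>

lemma Abel_mean_primepow_harm_le:
  assumes r: "r = exp (-\<sigma>)" and \<sigma>: "\<sigma> > 0"
    and summ: "summable (\<lambda>m. (primepow_harm (nat \<lfloor>exp (real m)\<rfloor>) - harm m) * r ^ m)"
  shows "(1 - r) * (\<Sum>m. (primepow_harm (nat \<lfloor>exp (real m)\<rfloor>) - harm m) * r ^ m) \<le> ln (1 + 1 / \<sigma>) + ln (1 - r)"
proof -
  define N where "N = (\<lambda>m. nat \<lfloor>exp (real m)\<rfloor>)"
  have r01: "0 < r" "r < 1" using r \<sigma> by auto
  have N_mono: "N m \<le> N (Suc m)" for m
    unfolding N_def by (intro nat_mono floor_mono) auto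
  \<comment> \<open>The boundary term with \<open>r ^ M\<close> makes the induction work: each step
    then adds just the block \<open>{N M<..N (Suc M)}\<close>, on which \<open>r ^ Suc M\<close> is
    at most n powr (-\<sigma>).\<close>
  have A: "(\<Sum>m<M. (r ^ m - r ^ Suc m) * primepow_harm (N m)) + r ^ M * primepow_harm (N M)
      \<le> (\<Sum>n\<le>N M. primepow_weight n * real n powr (-(1 + \<sigma>)))" for M
  proof (induction M)
    case 0
    then show ?case by (simp add: N_def primepow_harm_def)
  next
    case (Suc M)
    have split: "(\<Sum>n\<le>N (Suc M). g n) = (\<Sum>n\<le>N M. g n) + (\<Sum>n\<in>{N M<..N (Suc M)}. g n)" for g :: "nat \<Rightarrow> real"
      using N_mono[of M] by (subst sum.union_disjoint[symmetric]) (auto intro!: sum.cong)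
    have "r ^ Suc M * (\<Sum>n\<in>{N M<..N (Suc M)}. primepow_weight n / real n)
        \<le> (\<Sum>n\<in>{N M<..N (Suc M)}. primepow_weight n * real n powr (-(1 + \<sigma>)))"
      unfolding sum_distrib_left
    proof (intro sum_mono)
      fix n assume n: "n \<in> {N M<..N (Suc M)}"
      then have "real n \<le> exp (real (Suc M))" "n > 0" unfolding N_def by (auto simp: le_nat_iff le_floor_iff)
      then have "exp (real (Suc M)) powr (-\<sigma>) \<le> real n powr (-\<sigma>)"
        using \<sigma> by (intro powr_mono2') auto
      also have "exp (real (Suc M)) powr (-\<sigma>) = r ^ Suc M"
        unfolding r by (subst exp_of_nat_mult[symmetric]) (simp add: powr_def)
      finally have "r ^ Suc M * (primepow_weight n / real n) \<le> real n powr (-\<sigma>) * (primepow_weight n / real n)"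
        by (intro mult_right_mono) (auto simp: primepow_weight_nonneg)
      also have "\<dots> = primepow_weight n * real n powr (-(1 + \<sigma>))"
        using \<open>n > 0\<close> powr_add[of "real n" "-1" "-\<sigma>"] by (simp add: powr_minus divide_inverse)
      finally show "r ^ Suc M * (primepow_weight n / real n) \<le> primepow_weight n * real n powr (-(1 + \<sigma>))" .
    qed
    moreover have "primepow_harm (N (Suc M)) = primepow_harm (N M) + (\<Sum>n\<in>{N M<..N (Suc M)}. primepow_weight n / real n)"
      unfolding primepow_harm_def split by simp
    ultimately show ?case using Suc unfolding split by (simp add: algebra_simps)
  qed
  have H: "(\<Sum>m<M. (r ^ m - r ^ Suc m) * harm m) + r ^ M * harm M = (\<Sum>m<Suc M. r ^ m / real m)" for M
  proof (induction M)
    case 0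
    show ?case by (simp add: harm_def)
  next
    case (Suc M)
    then show ?case by (simp add: harm_Suc algebra_simps inverse_eq_divide)
  qed
  have harm_le: "harm M \<le> real M" for M
  proof (induction M)
    case (Suc M)
    have "inverse (real (Suc M)) \<le> 1" by (simp add: field_simps)
    then show ?case using Suc by (simp add: harm_Suc)
  qed (simp add: harm_def)
  define T where "T = (\<lambda>m. (primepow_harm (N m) - harm m) * r ^ m)"
  have le: "(1 - r) * (\<Sum>m<M. T m) \<le> ln (1 + 1 / \<sigma>) - (\<Sum>m<Suc M. r ^ m / real m) + real M * r ^ M" for M
  proof -
    have "(1 - r) * (\<Sum>m<M. T m) = (\<Sum>m<M. (r ^ m - r ^ Suc m) * primepow_harm (N m)) - (\<Sum>m<M. (r ^ m - r ^ Suc m) * harm m)"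
      unfolding sum_distrib_left T_def sum_subtractf[symmetric] by (intro sum.cong) (auto simp: algebra_simps)
    \<comment> \<open>Of the two boundary terms this one is dropped by its sign; the other is at
      most M r^M, which tends to 0.\<close>
    moreover have "r ^ M * primepow_harm (N M) \<ge> 0"
      using r01 by (auto simp: primepow_harm_def intro!: mult_nonneg_nonneg divide_nonneg_nonneg sum_nonneg primepow_weight_nonneg)
    moreover have "r ^ M * harm M \<le> real M * r ^ M"
      using r01 harm_le[of M] by (simp add: mult.commute)
    ultimately show ?thesis
      using A[of M] H[of M] sum_primepow_weight_powr_le[OF \<sigma>, of "{..N M}"] by simp
  qed
  have "(1 - r) * (\<Sum>m. T m) \<le> ln (1 + 1 / \<sigma>) - (- ln (1 - r)) + 0"
  proof (rule LIMSEQ_le)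
    show "(\<lambda>M. (1 - r) * (\<Sum>m<M. T m)) \<longlonglongrightarrow> (1 - r) * (\<Sum>m. T m)"
      using summ unfolding T_def N_def by (intro tendsto_intros summable_LIMSEQ)
    have "(\<lambda>m. r ^ m / real m) sums (- ln (1 - r))"
      using sums_minus[OF ln_series'[of "-r"]] r01 by simp
    then have "(\<lambda>M. \<Sum>m<Suc M. r ^ m / real m) \<longlonglongrightarrow> - ln (1 - r)"
      unfolding sums_def by (rule LIMSEQ_Suc)
    moreover have "(\<lambda>M. real M * r ^ M) \<longlonglongrightarrow> 0"
      using powser_times_n_limit_0[of r] r01 by simp
    ultimately show "(\<lambda>M. ln (1 + 1 / \<sigma>) - (\<Sum>m<Suc M. r ^ m / real m) + real M * r ^ M)
        \<longlonglongrightarrow> ln (1 + 1 / \<sigma>) - (- ln (1 - r)) + 0"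
      by (intro tendsto_intros)
  qed (use le in blast)
  then show ?thesis by (simp add: T_def N_def)
qed

theorem primepow_harm_asymp_le:
  assumes "e > 0"
  shows "eventually (\<lambda>n. primepow_harm n \<le> ln (ln (real n)) + euler_mascheroni + e) sequentially"
proof -
  obtain C where C: "(\<lambda>n. primepow_harm n - ln (ln (real n))) \<longlonglongrightarrow> C"
    using convergent_primepow_harm by (auto simp: convergent_def)
  define S where "S = (\<lambda>m. primepow_harm (nat \<lfloor>exp (real m)\<rfloor>) - harm m)"
  have S: "S \<longlonglongrightarrow> C + 0 - euler_mascheroni"
  proof (rule Lim_transform_eventually)
    have "filterlim (\<lambda>m. nat \<lfloor>exp (real m)\<rfloor>) sequentially sequentially"
      by (intro filterlim_compose[OF filterlim_nat_sequentially] filterlim_compose[OF filterlim_floor_sequentially])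
        real_asymp
    from tendsto_diff[OF tendsto_add[OF filterlim_compose[OF C this] ln_ln_floor_exp_tendsto] euler_mascheroni_LIMSEQ]
    show "(\<lambda>m. primepow_harm (nat \<lfloor>exp (real m)\<rfloor>) - ln (ln (real (nat \<lfloor>exp (real m)\<rfloor>)))
        + (ln (ln (real (nat \<lfloor>exp (real m)\<rfloor>))) - ln (real m)) - (harm m - ln (real m))) \<longlonglongrightarrow> C + 0 - euler_mascheroni"
      by simp
  qed (simp add: S_def)
  \<comment> \<open>S converges to C - \<gamma>, hence so do its Abel means. With \<sigma> = - ln r
    they are at most ln (1 + 1 / \<sigma>) + ln (1 - r), which tends to 0.\<close>
  have "C + 0 - euler_mascheroni \<le> 0"
  proof (rule tendsto_le[OF _ _ Abel_means_tendsto[OF S]])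
    show "((\<lambda>r::real. ln (1 + 1 / (- ln r)) + ln (1 - r)) \<longlongrightarrow> 0) (at_left 1)" by real_asymp
    have "eventually (\<lambda>r. r \<in> {0<..<1::real}) (at_left 1)"
      by (rule eventually_at_left_real) auto
    then show "eventually (\<lambda>r. (1 - r) * (\<Sum>m. S m * r ^ m) \<le> ln (1 + 1 / (- ln r)) + ln (1 - r)) (at_left 1)"
    proof eventually_elim
      case (elim r)
      obtain B where B: "\<And>m. \<bar>S m\<bar> \<le> B"
        using convergent_imp_Bseq[OF convergentI[OF S]] by (auto simp: Bseq_def)
      have "summable (\<lambda>m. S m * r ^ m)"
        by (rule summable_comparison_test'[OF summable_mult[OF summable_geometric[of r], of B], of 0])
           (use elim B in \<open>auto simp: abs_mult intro!: mult_right_mono\<close>)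
      then show ?case
        unfolding S_def using elim by (intro Abel_mean_primepow_harm_le) auto
    qed
  qed auto
  then have "C < euler_mascheroni + e" using assms by simp
  from order_tendstoD(2)[OF C this] show ?thesis
    by eventually_elim simp
qed

section \<open>L-functions of cubic characters\<close>

locale cubic_char =
  fixes q :: nat and chi :: "nat \<Rightarrow> complex"
  assumes order3: "char_order3 q chi"
begin

lemma chi_mult: "chi (m * n) = chi m * chi n"
  and chi_add_q: "chi (n + q) = chi n"
  and chi_eq_0_iff: "chi n = 0 \<longleftrightarrow> \<not> coprime n q"
  and q_pos: "q > 0"
  and chi_cube: "chi n ^ 3 = (if coprime n q then 1 else 0)"
  and not_principal: "\<not> principal_char q chi"
  using order3 unfolding char_order3_def dirichlet_char_def by auto

lemma chi_1: "chi 1 = 1" "chi (Suc 0) = 1"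
proof -
  have "chi 1 * chi 1 = chi 1" using chi_mult[of 1 1] by simp
  moreover have "chi 1 \<noteq> 0" using chi_eq_0_iff[of 1] by simp
  ultimately show "chi 1 = 1" by simp
  then show "chi (Suc 0) = 1" by simp
qed

lemma norm_chi: "norm (chi n) = (if coprime n q then 1 else 0)"
proof (cases "coprime n q")
  case True
  then have "norm (chi n) ^ 3 = 1" using chi_cube[of n] by (simp add: norm_power[symmetric])
  then show ?thesis using True power_eq_imp_eq_base[of "norm (chi n)" 3 1] by simp
qed (simp add: chi_eq_0_iff)

lemma norm_chi_le_1: "norm (chi n) \<le> 1"
  by (simp add: norm_chi)

lemma chi_add_mult_q: "chi (n + k * q) = chi n"
proof (induction k)
  case (Suc k)
  then show ?case using chi_add_q[of "n + k * q"] by (simp add: add_ac)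
qed auto

lemma chi_mod_q: "chi (n mod q) = chi n"
  using chi_add_mult_q[of "n mod q" "n div q"] by simp

lemma q_gt_1: "q > 1"
proof (rule ccontr)
  assume "\<not> q > 1"
  then have "q = 1" using q_pos by simp
  then have "chi n = 1" for n
    using chi_mod_q[of n] chi_mod_q[of 1] chi_1 by simp
  then show False using not_principal \<open>q = 1\<close> by (simp add: principal_char_def)
qed

lemma chi_0: "chi 0 = 0"
  using q_gt_1 by (simp add: chi_eq_0_iff)

text \<open>Multiplication by a unit a with \<open>chi a \<noteq> 1\<close> permutes the residues,
  so the sum equals \<open>chi a\<close> times itself.\<close>

lemma sum_chi_period: "(\<Sum>n<q. chi n) = 0"
proof -
  obtain a where a: "coprime a q" "chi a \<noteq> 1"
    using not_principal chi_eq_0_iff unfolding principal_char_def by metis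
  have inj: "inj_on (\<lambda>n. a * n mod q) {..<q}"
  proof (rule inj_onI)
    fix x y assume xy: "x \<in> {..<q}" "y \<in> {..<q}" "a * x mod q = a * y mod q"
    then have "[x = y] (mod q)" using a by (simp add: cong_def[symmetric] cong_mult_lcancel_nat)
    then show "x = y" using xy by (simp add: cong_def)
  qed
  have "(\<lambda>n. a * n mod q) ` {..<q} = {..<q}"
    using q_pos by (intro endo_inj_surj inj) auto
  with inj have "(\<Sum>n<q. chi n) = (\<Sum>n<q. chi (a * n mod q))"
    by (metis (no_types, lifting) sum.reindex_cong)
  also have "\<dots> = chi a * (\<Sum>n<q. chi n)"
    by (simp add: chi_mod_q chi_mult sum_distrib_left)
  finally show ?thesis using a by simp
qed

text \<open>Whole periods cancel, which leaves fewer than q terms. So crude a bound is enough, since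
  only its logarithm will matter.\<close>

lemma norm_sum_chi_le: "norm (\<Sum>j\<le>n. chi j) \<le> real q"
proof -
  have shift: "(\<Sum>j<q + n. chi j) = (\<Sum>j<n. chi j)" for n
    by (induction n) (use sum_chi_period chi_add_q in \<open>auto simp: add.commute\<close>)
  have "norm (\<Sum>j<n. chi j) \<le> real q" for n
  proof (induction n rule: less_induct)
    case (less n)
    show ?case
    proof (cases "n < q")
      case True
      have "norm (\<Sum>j<n. chi j) \<le> (\<Sum>j<n. 1)"
        by (intro sum_norm_le norm_chi_le_1)
      then show ?thesis using True by simp
    next
      case False
      then show ?thesis using shift[of "n - q"] less[of "n - q"] q_pos by simp
    qed
  qed
  from this[of "Suc n"] show ?thesis by (simp add: lessThan_Suc_atMost)
qed

text \<open>The 3-4-1 inequality involves L(s, \<chi>^2); as another instance of the locale,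
  \<chi>^2 inherits all bounds proved for \<chi>.\<close>

lemma cubic_char_square: "cubic_char q (\<lambda>n. chi n ^ 2)"
proof
  have "\<not> principal_char q (\<lambda>n. chi n ^ 2)"
  proof
    assume *: "principal_char q (\<lambda>n. chi n ^ 2)"
    have "chi n = (if coprime n q then 1 else 0)" for n
    proof (cases "coprime n q")
      case True
      then have "chi n ^ 2 = 1" "chi n ^ 3 = 1" using * chi_cube by (auto simp: principal_char_def)
      then show ?thesis using True by (simp add: power3_eq_cube power2_eq_square)
    qed (use chi_eq_0_iff in auto)
    then show False using not_principal by (simp add: principal_char_def)
  qed
  moreover have "(chi n ^ 2) ^ 3 = (if coprime n q then 1 else 0)" for n
  proof -
    have "(chi n ^ 2) ^ 3 = (chi n ^ 3) ^ 2" by (simp add: power_mult[symmetric])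
    then show ?thesis by (simp add: chi_cube)
  qed
  ultimately show "char_order3 q (\<lambda>n. chi n ^ 2)"
    unfolding char_order3_def dirichlet_char_def
    using q_pos chi_mult chi_add_q chi_eq_0_iff by (auto simp: power_mult_distrib)
qed

end

section \<open>The Dirichlet series to the right of Re s = 1/2\<close>

lemma norm_of_nat_powr: "norm (of_nat n powr s :: complex) = real n powr Re s"
  by (cases "n = 0") (auto simp: norm_powr_real_powr)

lemma of_nat_mult_powr: "of_nat (m * n) powr s = of_nat m powr s * (of_nat n powr s :: complex)"
  by (simp add: powr_times_real)

lemma norm_powr_diff_le:
  assumes "n \<ge> 1" "Re s \<ge> 0"
  shows "norm (of_nat n powr (-s) - of_nat (Suc n) powr (-s) :: complex) \<le> norm s * real n powr (- Re s - 1)"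
proof -
  let ?S = "closed_segment (complex_of_real (real n)) (complex_of_real (real n + 1))"
  have S: "\<exists>u. z = of_real u \<and> real n \<le> u" if "z \<in> ?S" for z
    using that unfolding closed_segment_of_real by (auto simp: closed_segment_eq_real_ivl)
  have "norm (complex_of_real (real n) powr (-s) - complex_of_real (real n + 1) powr (-s))
      \<le> (norm s * real n powr (- Re s - 1)) * norm (complex_of_real (real n) - complex_of_real (real n + 1))"
  proof (rule field_differentiable_bound[of ?S])
    fix z assume "z \<in> ?S"
    then obtain u where u: "z = of_real u" "real n \<le> u" using S by blast
    then have u0: "u > 0" using assms by simp
    then show "((\<lambda>z. z powr (-s)) has_field_derivative (-s) * z powr (-s - 1)) (at z within ?S)"
      unfolding u by (intro has_field_derivative_powr has_field_derivative_at_within) (auto simp: complex_nonpos_Reals_iff)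
    have "norm (z powr (-s - 1)) = u powr (- Re s - 1)"
      using u0 unfolding u by (subst norm_powr_real_powr) auto
    also have "\<dots> \<le> real n powr (- Re s - 1)"
      using u assms by (intro powr_mono2') auto
    finally show "norm ((-s) * z powr (-s - 1)) \<le> norm s * real n powr (- Re s - 1)"
      by (simp add: norm_mult mult_left_mono)
  qed auto
  also have "norm (complex_of_real (real n) - complex_of_real (real n + 1)) = 1"
    by simp
  finally show ?thesis by (simp add: add.commute)
qed

context cubic_char
begin

text \<open>For Re s \<le> 1 the Dirichlet series converges only conditionally. These are its terms
  after summation by parts; they form an absolutely and locally uniformly convergent series for Re s
  > 1/2.\<close>

definition L_term :: "nat \<Rightarrow> complex \<Rightarrow> complex" where
  "L_term n s = (\<Sum>j\<le>n. chi j) * (of_nat n powr (-s) - of_nat (Suc n) powr (-s))"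

lemma summable_powr_diff:
  assumes "Re s \<ge> 1/2"
  shows "summable (\<lambda>n. norm (of_nat n powr (-s) - of_nat (Suc n) powr (-s) :: complex))"
    and "(\<Sum>n. norm (of_nat n powr (-s) - of_nat (Suc n) powr (-s) :: complex)) \<le> 1 + 3 * norm s"
proof -
  let ?b = "\<lambda>n. norm (of_nat n powr (-s) - of_nat (Suc n) powr (-s) :: complex)"
  \<comment> \<open>The summand at n = 0 is \<open>0 powr (-s) - 1\<close>, of norm 1 since
    \<open>0 powr (-s)\<close> is 0. It gives the 1 in the bound; the factor 3 is the estimate for
    \<zeta>(3/2).\<close>
  have le: "?b n \<le> norm s * real n powr (-(1 + 1/2)) + (if n = 0 then 1 else 0)" for n
  proof (cases "n = 0")
    case False
    then have "?b n \<le> norm s * real n powr (- Re s - 1)"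
      using assms by (intro norm_powr_diff_le) auto
    also have "\<dots> \<le> norm s * real n powr (-(1 + 1/2))"
      using assms False by (intro mult_left_mono powr_mono) auto
    finally show ?thesis using False by simp
  qed auto
  note z = zeta_real_le[of "1/2", simplified]
  have s1: "summable (\<lambda>n::nat. if n = 0 then 1 else 0 :: real)"
    by (rule summable_finite[of "{0}"]) auto
  have s1': "(\<Sum>n::nat. if n = 0 then 1 else 0 :: real) = 1"
    by (subst suminf_finite[of "{0}"]) auto
  have s: "summable (\<lambda>n. norm s * real n powr (-(1 + 1/2)) + (if n = 0 then 1 else 0))"
    using z by (intro summable_add summable_mult s1) auto
  then show sb: "summable ?b"
    by (rule summable_comparison_test'[of _ 0]) (use le in auto)
  have "(\<Sum>n. ?b n) \<le> (\<Sum>n. norm s * real n powr (-(1 + 1/2)) + (if n = 0 then 1 else 0))"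
    by (rule suminf_le[OF le sb s])
  also have "\<dots> = norm s * (\<Sum>n. real n powr (-(1 + 1/2))) + 1"
    using z(1) by (subst suminf_add[symmetric, OF summable_mult s1]) (auto simp: suminf_mult s1')
  also have "\<dots> \<le> norm s * 3 + 1"
    using z(2) by (intro add_right_mono mult_left_mono) auto
  finally show "(\<Sum>n. ?b n) \<le> 1 + 3 * norm s" by simp
qed

lemma
  assumes "Re s \<ge> 1/2"
  shows dirichlet_L_eq: "dirichlet_L chi s = (\<Sum>n. L_term n s)"
    and norm_dirichlet_L_le: "norm (dirichlet_L chi s) \<le> real q * (1 + 3 * norm s)"
proof -
  have lim: "(\<lambda>n. of_nat n powr (-s) :: complex) \<longlonglongrightarrow> 0"
  proof (rule tendsto_norm_zero_cancel)
    show "(\<lambda>n. norm (of_nat n powr (-s) :: complex)) \<longlonglongrightarrow> 0"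
      unfolding norm_of_nat_powr using assms by real_asymp
  qed
  note D = Dirichlet_test[OF norm_sum_chi_le lim summable_powr_diff(1)[OF assms]]
  have L: "dirichlet_L chi s = (\<Sum>n. chi n * of_nat n powr (-s))"
    by (simp add: dirichlet_L_def powr_minus divide_inverse)
  show "dirichlet_L chi s = (\<Sum>n. L_term n s)"
    using D(1) unfolding L L_term_def by (simp add: sums_iff)
  show "norm (dirichlet_L chi s) \<le> real q * (1 + 3 * norm s)"
    unfolding L by (rule order.trans[OF D(2) mult_left_mono[OF summable_powr_diff(2)[OF assms]]]) simp
qed

lemma holomorphic_dirichlet_L: "dirichlet_L chi holomorphic_on {s. Re s > 1/2}"
proof -
  have op: "open {s. Re s > 1/2}" by (rule open_halfspace_Re_gt)
  have "(\<lambda>s. \<Sum>n. L_term n s) holomorphic_on {s. Re s > 1/2}"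
  proof (rule holomorphic_uniform_sequence[OF op])
    show "(\<lambda>s. \<Sum>k<n. L_term k s) holomorphic_on {s. Re s > 1/2}" for n
      unfolding L_term_def by (intro holomorphic_intros)
    fix x assume "x \<in> {s. Re s > 1/2}"
    then obtain d where d: "d > 0" "cball x d \<subseteq> {s. Re s > 1/2}"
      using op open_contains_cball by blast
    have "uniform_limit (cball x d) (\<lambda>n s. \<Sum>k<n. L_term k s) (\<lambda>s. \<Sum>n. L_term n s) sequentially"
    proof (rule Weierstrass_m_test)
      fix n s assume s: "s \<in> cball x d"
      then have re: "Re s \<ge> 1/2" using d by auto
      have ns: "norm s \<le> norm x + d"
        using s norm_triangle_sub[of s x] by (simp add: dist_norm norm_minus_commute)
      have "norm (of_nat n powr (-s) - of_nat (Suc n) powr (-s) :: complex)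
          \<le> (norm x + d) * real n powr (-(1 + 1/2)) + (if n = 0 then 1 else 0)"
      proof (cases "n = 0")
        case False
        then have "norm (of_nat n powr (-s) - of_nat (Suc n) powr (-s) :: complex) \<le> norm s * real n powr (- Re s - 1)"
          using re by (intro norm_powr_diff_le) auto
        also have "\<dots> \<le> (norm x + d) * real n powr (-(1 + 1/2))"
          using re False ns d by (intro mult_mono powr_mono) (auto simp: add_nonneg_nonneg)
        finally show ?thesis using False by simp
      qed auto
      then show "norm (L_term n s) \<le> real q * ((norm x + d) * real n powr (-(1 + 1/2)) + (if n = 0 then 1 else 0))"
        unfolding L_term_def norm_mult using norm_sum_chi_le[of n] by (intro mult_mono) auto
    next
      have "summable (\<lambda>n::nat. if n = 0 then 1 else 0 :: real)"
        by (rule summable_finite[of "{0}"]) auto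
      then show "summable (\<lambda>n. real q * ((norm x + d) * real n powr (-(1 + 1/2)) + (if n = 0 then 1 else 0)))"
        by (intro summable_mult summable_add zeta_real_le) auto
    qed
    with d show "\<exists>d>0. cball x d \<subseteq> {s. Re s > 1/2} \<and>
        uniform_limit (cball x d) (\<lambda>n s. \<Sum>k<n. L_term k s) (\<lambda>s. \<Sum>n. L_term n s) sequentially"
      by blast
  qed
  then show ?thesis
    by (rule holomorphic_transform) (simp add: dirichlet_L_eq)
qed

definition logL_term :: "nat \<Rightarrow> complex \<Rightarrow> complex" where
  "logL_term n s = of_real (primepow_weight n) * (chi n * of_nat n powr (-s))"

lemma norm_logL_term_le: "norm (logL_term n s) \<le> primepow_weight n * real n powr (- Re s)"
proof -
  have "norm (chi n) * real n powr (- Re s) \<le> real n powr (- Re s)"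
    using norm_chi_le_1[of n] by (simp add: mult_left_le_one_le)
  then show ?thesis
    unfolding logL_term_def norm_mult norm_of_nat_powr
    by (simp add: primepow_weight_nonneg mult_left_mono)
qed

lemma
  assumes "Re s > 1"
  shows summable_logL_term: "summable (\<lambda>n. norm (logL_term n s))"
    and exp_logL: "exp (\<Sum>n. logL_term n s) = dirichlet_L chi s"
proof -
  have "summable (\<lambda>n. real n powr (- Re s))"
    using assms by (subst summable_real_powr_iff) auto
  then have s: "summable (\<lambda>n. norm (chi n * of_nat n powr (-s)))"
    by (rule summable_comparison_test'[of _ 0])
      (auto simp: norm_mult norm_of_nat_powr norm_chi_le_1 intro!: mult_left_le_one_le)
  then show "summable (\<lambda>n. norm (logL_term n s))"
    unfolding logL_term_def by (rule summable_primepow_weight)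
  have "exp (\<Sum>n. logL_term n s) = (\<Sum>n. chi n * of_nat n powr (-s))"
    unfolding logL_term_def
    by (rule exp_primepow_weight_series)
      (use s chi_0 chi_1 chi_mult in \<open>auto simp: of_nat_mult_powr mult_ac simp del: of_nat_mult\<close>)
  then show "exp (\<Sum>n. logL_term n s) = dirichlet_L chi s"
    by (simp add: dirichlet_L_def powr_minus divide_inverse)
qed

end

section \<open>The logarithm of the L-function under GRH\<close>

text \<open>This is 3 + 4 cos a + cos 2a = 2 (1 + cos a)^2 for w = exp (i a); the value w = 0 occurs
  at n not coprime to q.\<close>

lemma three_four_one:
  fixes w :: complex
  assumes "norm w = 1 \<or> w = 0"
  shows "3 + 4 * Re w + Re (w ^ 2) \<ge> 0"
  using assms
proof
  assume "norm w = 1"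
  then have "(Re w)\<^sup>2 + (Im w)\<^sup>2 = 1" by (simp add: cmod_def)
  then have "3 + 4 * Re w + Re (w ^ 2) = 2 * (1 + Re w)\<^sup>2"
    by (simp add: power2_eq_square algebra_simps)
  then show ?thesis by simp
qed auto

section \<open>Nonvanishing and a holomorphic logarithm for Re s > 1/2\<close>

context cubic_char
begin

text \<open>In the logarithm of \<zeta>(1+\<sigma>)^3 |L(1+\<sigma>+it, \<chi>)|^4
  |L(1+\<sigma>+2it, \<chi>^2)| every prime power contributes a nonnegative multiple of 3 + 4 Re w +
  Re w^2. The zeta factor is then replaced by its bound.\<close>

lemma one_le_341_product:
  assumes \<sigma>: "\<sigma> > 0"
  shows "1 \<le> (1 + 1 / \<sigma>) ^ 3 * norm (dirichlet_L chi (Complex (1 + \<sigma>) t)) ^ 4 *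
             norm (dirichlet_L (\<lambda>n. chi n ^ 2) (Complex (1 + \<sigma>) (2 * t)))"
proof -
  interpret sq: cubic_char q "\<lambda>n. chi n ^ 2" by (rule cubic_char_square)
  let ?s = "Complex (1 + \<sigma>) t" and ?s2 = "Complex (1 + \<sigma>) (2 * t)"
  have s1: "summable (\<lambda>n. logL_term n ?s)" and s2: "summable (\<lambda>n. sq.logL_term n ?s2)"
    using \<sigma> by (auto intro!: summable_norm_cancel[OF summable_logL_term] summable_norm_cancel[OF sq.summable_logL_term])
  note z = zeta_real_le[OF \<sigma>]
  have s0: "summable (\<lambda>n. primepow_weight n * real n powr (-(1 + \<sigma>)))"
    by (rule summable_comparison_test'[OF z(1), of 0])
      (auto simp: abs_mult primepow_weight_nonneg intro!: mult_left_le_one_le primepow_weight_le_1)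
  have e: "exp (\<Sum>n. primepow_weight n * real n powr (-(1 + \<sigma>))) = (\<Sum>n. real n powr (-(1 + \<sigma>)))"
    by (rule exp_primepow_weight_series_real) (use z(1) in \<open>auto simp: powr_mult\<close>)
  have "0 \<le> (\<Sum>n. 3 * (primepow_weight n * real n powr (-(1 + \<sigma>))) + 4 * Re (logL_term n ?s) + Re (sq.logL_term n ?s2))"
  proof (rule suminf_nonneg)
    show "summable (\<lambda>n. 3 * (primepow_weight n * real n powr (-(1 + \<sigma>))) + 4 * Re (logL_term n ?s) + Re (sq.logL_term n ?s2))"
      by (intro summable_add summable_mult s0 summable_Re s1 s2)
    fix n
    \<comment> \<open>Squaring the character and doubling the height together turn w into
      w^2.\<close>
    define w where "w = chi n * of_nat n powr (- (\<i> * of_real t))"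
    have "norm w = 1 \<or> w = 0"
      by (cases "n = 0") (auto simp: w_def norm_mult norm_of_nat_powr norm_chi chi_eq_0_iff)
    then have w: "3 + 4 * Re w + Re (w ^ 2) \<ge> 0" by (rule three_four_one)
    have p: "of_nat n powr (- Complex (1 + \<sigma>) u) = of_real (real n powr (-(1 + \<sigma>))) * of_nat n powr (- (\<i> * of_real u))" for u
    proof -
      have "- Complex (1 + \<sigma>) u = of_real (-(1 + \<sigma>)) + (- (\<i> * of_real u))"
        by (simp add: complex_eq_iff)
      then have "of_nat n powr (- Complex (1 + \<sigma>) u) = of_nat n powr (of_real (-(1 + \<sigma>))) * of_nat n powr (- (\<i> * of_real u))"
        by (simp only: powr_add)
      moreover have "(of_nat n powr of_real (-(1 + \<sigma>)) :: complex) = of_real (real n powr (-(1 + \<sigma>)))"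
        using powr_of_real[of "real n" "-(1 + \<sigma>)"] by simp
      ultimately show ?thesis by simp
    qed
    have p2: "of_nat n powr (- (\<i> * of_real (2 * t))) = (of_nat n powr (- (\<i> * of_real t)) :: complex) ^ 2"
      unfolding power2_eq_square powr_add[symmetric] by (simp add: algebra_simps)
    define c where "c = primepow_weight n * real n powr (-(1 + \<sigma>))"
    have t1: "logL_term n ?s = of_real c * w"
      unfolding logL_term_def p w_def c_def by (simp add: mult_ac)
    have t2: "sq.logL_term n ?s2 = of_real c * w ^ 2"
      unfolding sq.logL_term_def p p2 w_def c_def by (simp add: mult_ac power_mult_distrib)
    have "3 * c + 4 * Re (logL_term n ?s) + Re (sq.logL_term n ?s2) = c * (3 + 4 * Re w + Re (w ^ 2))"
      unfolding t1 t2 by (simp add: algebra_simps)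
    moreover have "c \<ge> 0" unfolding c_def by (simp add: primepow_weight_nonneg)
    ultimately show "0 \<le> 3 * (primepow_weight n * real n powr (-(1 + \<sigma>))) + 4 * Re (logL_term n ?s) + Re (sq.logL_term n ?s2)"
      unfolding c_def [symmetric] using w by simp
  qed
  also have "\<dots> = 3 * (\<Sum>n. primepow_weight n * real n powr (-(1 + \<sigma>))) + 4 * Re (\<Sum>n. logL_term n ?s) + Re (\<Sum>n. sq.logL_term n ?s2)"
    using s0 s1 s2
    by (simp add: suminf_add[symmetric] summable_add summable_mult summable_Re suminf_mult Re_suminf[symmetric])
  finally have "1 \<le> exp (3 * (\<Sum>n. primepow_weight n * real n powr (-(1 + \<sigma>))) + 4 * Re (\<Sum>n. logL_term n ?s) + Re (\<Sum>n. sq.logL_term n ?s2))"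
    by simp
  also have "\<dots> = (\<Sum>n. real n powr (-(1 + \<sigma>))) ^ 3 * norm (dirichlet_L chi ?s) ^ 4 * norm (dirichlet_L (\<lambda>n. chi n ^ 2) ?s2)"
    using \<sigma> by (simp add: exp_add exp_of_nat_mult[of 3, simplified] exp_of_nat_mult[of 4, simplified] e[simplified]
        flip: exp_logL sq.exp_logL norm_exp_eq_Re)
  also have "\<dots> \<le> (1 + 1 / \<sigma>) ^ 3 * norm (dirichlet_L chi ?s) ^ 4 * norm (dirichlet_L (\<lambda>n. chi n ^ 2) ?s2)"
    by (intro mult_right_mono power_mono z(2) suminf_nonneg z(1)) auto
  finally show ?thesis .
qed

text \<open>A zero would make the 3-4-1 product of size \<sigma>^-3 \<sigma>^4 and contradict its
  lower bound 1. The last factor stays bounded even at t = 0, because \<chi>^2 is nonprincipal; the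
  difficulty with real characters does not arise for order 3.\<close>

lemma dirichlet_L_nonzero_line_1: "dirichlet_L chi (Complex 1 t) \<noteq> 0"
proof
  assume zero: "dirichlet_L chi (Complex 1 t) = 0"
  interpret sq: cubic_char q "\<lambda>n. chi n ^ 2" by (rule cubic_char_square)
  define K where "K = real q * (1 + 3 * (2 + \<bar>2 * t\<bar>))"
  obtain D where "(dirichlet_L chi has_field_derivative D) (at (Complex 1 t))"
    using holomorphic_on_imp_differentiable_at[OF holomorphic_dirichlet_L open_halfspace_Re_gt, of "Complex 1 t"]
    by (auto simp: field_differentiable_def)
  then have "((\<lambda>h. dirichlet_L chi (Complex 1 t + h) / h) \<longlongrightarrow> D) (at 0)"
    unfolding DERIV_def using zero by simp
  moreover have "filterlim complex_of_real (at 0) (at_right 0)"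
    by (auto simp: filterlim_at eventually_at_filter intro!: tendsto_eq_intros)
  ultimately have "((\<lambda>\<sigma>. dirichlet_L chi (Complex 1 t + of_real \<sigma>) / of_real \<sigma>) \<longlongrightarrow> D) (at_right 0)"
    by (rule filterlim_compose)
  \<comment> \<open>\<open>K\<close> bounds the factor for \<chi>^2 when 0 < \<sigma> < 1, and 8
    \<sigma> is what remains of (2 / \<sigma>)^3 once each of the four factors L has been divided by
    \<sigma>.\<close>
  then have lim: "((\<lambda>\<sigma>. 8 * \<sigma> * norm (dirichlet_L chi (Complex 1 t + of_real \<sigma>) / of_real \<sigma>) ^ 4 * K) \<longlongrightarrow> 8 * 0 * norm D ^ 4 * K) (at_right 0)"
    by (intro tendsto_intros)
  have "(1::real) \<le> 8 * 0 * norm D ^ 4 * K"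
  proof (rule tendsto_lowerbound[OF lim])
    have "eventually (\<lambda>\<sigma>. \<sigma> \<in> {0<..<1::real}) (at_right 0)"
      by (rule eventually_at_right_real) auto
    then show "eventually (\<lambda>\<sigma>. 1 \<le> 8 * \<sigma> * norm (dirichlet_L chi (Complex 1 t + of_real \<sigma>) / of_real \<sigma>) ^ 4 * K) (at_right 0)"
    proof eventually_elim
      case (elim \<sigma>)
      then have \<sigma>: "0 < \<sigma>" "\<sigma> < 1" by auto
      let ?L = "norm (dirichlet_L chi (Complex (1 + \<sigma>) t))"
      have "norm (dirichlet_L (\<lambda>n. chi n ^ 2) (Complex (1 + \<sigma>) (2 * t))) \<le> real q * (1 + 3 * norm (Complex (1 + \<sigma>) (2 * t)))"
        using \<sigma> by (intro sq.norm_dirichlet_L_le) auto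
      also have "\<dots> \<le> K"
        unfolding K_def using cmod_le[of "Complex (1 + \<sigma>) (2 * t)"] \<sigma> by (intro mult_left_mono) auto
      finally have K: "norm (dirichlet_L (\<lambda>n. chi n ^ 2) (Complex (1 + \<sigma>) (2 * t))) \<le> K" .
      have "1 + 1 / \<sigma> \<le> 2 / \<sigma>" using \<sigma> by (simp add: field_simps)
      then have "(1 + 1 / \<sigma>) ^ 3 * ?L ^ 4 * norm (dirichlet_L (\<lambda>n. chi n ^ 2) (Complex (1 + \<sigma>) (2 * t)))
         \<le> (2 / \<sigma>) ^ 3 * ?L ^ 4 * K"
        using \<sigma> K by (intro mult_mono power_mono) auto
      then have "1 \<le> (2 / \<sigma>) ^ 3 * ?L ^ 4 * K" using one_le_341_product[OF \<sigma>(1), of t] by linarith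
      also have "(2 / \<sigma>) ^ 3 * ?L ^ 4 * K = 8 * \<sigma> * (?L / \<sigma>) ^ 4 * K"
        using \<sigma> by (simp add: field_simps power_divide eval_nat_numeral)
      also have "Complex (1 + \<sigma>) t = Complex 1 t + of_real \<sigma>" by (simp add: complex_eq_iff)
      finally show ?case using \<sigma> by (simp add: norm_divide)
    qed
  qed auto
  then show False by simp
qed

lemma dirichlet_L_nonzero:
  assumes GRH "Re s > 1/2"
  shows "dirichlet_L chi s \<noteq> 0"
proof -
  consider "Re s < 1" | "Re s = 1" | "Re s > 1" by linarith
  then show ?thesis
  proof cases
    case 1
    then show ?thesis using assms order3 unfolding GRH_def char_order3_def by blast
  next
    case 2
    then have "s = Complex 1 (Im s)" by (simp add: complex_eq_iff)
    then show ?thesis using dirichlet_L_nonzero_line_1[of "Im s"] by simp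
  next
    case 3
    then show ?thesis using exp_logL[of s] by (metis exp_not_eq_zero)
  qed
qed

text \<open>The series is at most ln \<zeta>(2) \<le> ln 2 there. It controls the logarithm at the
  centre of the Borel--Caratheodory disc.\<close>

lemma norm_logL_le:
  assumes "Re s \<ge> 2"
  shows "norm (\<Sum>n. logL_term n s) \<le> 1"
proof -
  have s: "summable (\<lambda>n. norm (logL_term n s))" using assms by (intro summable_logL_term) auto
  have "norm (\<Sum>n. logL_term n s) \<le> (\<Sum>n. norm (logL_term n s))" by (rule summable_norm[OF s])
  also have "\<dots> \<le> ln (1 + 1 / 1)"
  proof (rule suminf_le_const[OF s])
    fix N
    have "(\<Sum>n<N. norm (logL_term n s)) \<le> (\<Sum>n<N. primepow_weight n * real n powr (-(1 + 1)))"
    proof (intro sum_mono)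
      fix n
      show "norm (logL_term n s) \<le> primepow_weight n * real n powr (-(1 + 1))"
      proof (cases "n = 0")
        case False
        then have "primepow_weight n * real n powr (- Re s) \<le> primepow_weight n * real n powr (-(1 + 1))"
          using assms by (intro mult_left_mono powr_mono primepow_weight_nonneg) auto
        then show ?thesis using norm_logL_term_le[of n s] by linarith
      qed (simp add: logL_term_def)
    qed
    also have "\<dots> \<le> ln (1 + 1 / 1)" by (rule sum_primepow_weight_powr_le) auto
    finally show "(\<Sum>n<N. norm (logL_term n s)) \<le> ln (1 + 1 / 1)" .
  qed
  also have "\<dots> \<le> 1" using ln_2_less_1 by simp
  finally show ?thesis .
qed

lemma continuous_logL: "continuous_on {s. Re s \<ge> 3/2} (\<lambda>s. \<Sum>n. logL_term n s)"
proof (rule uniform_limit_theorem)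
  show "uniform_limit {s. Re s \<ge> 3/2} (\<lambda>N s. \<Sum>n<N. logL_term n s) (\<lambda>s. \<Sum>n. logL_term n s) sequentially"
  proof (rule Weierstrass_m_test)
    fix n s assume s: "s \<in> {s. Re s \<ge> 3/2}"
    have "norm (logL_term n s) \<le> primepow_weight n * real n powr (- Re s)" by (rule norm_logL_term_le)
    also have "\<dots> \<le> real n powr (- Re s)"
      by (intro mult_left_le_one_le primepow_weight_nonneg primepow_weight_le_1) auto
    also have "\<dots> \<le> real n powr (-(1 + 1/2))"
      using s by (cases "n = 0") (auto intro!: powr_mono)
    finally show "norm (logL_term n s) \<le> real n powr (-(1 + 1/2))" .
  qed (intro zeta_real_le, simp)
  show "eventually (\<lambda>N. continuous_on {s. Re s \<ge> 3/2} (\<lambda>s. \<Sum>n<N. logL_term n s)) sequentially"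
  proof (intro always_eventually allI continuous_on_sum)
    show "continuous_on {s. Re s \<ge> 3/2} (logL_term n)" for n
      unfolding logL_term_def
      by (cases "n = 0") (auto intro!: continuous_intros)
  qed
qed auto

text \<open>Any holomorphic logarithm differs from the series by a multiple of 2 pi i at each point
  with Re s \<ge> 3/2, hence by one constant on that connected set. Subtracting it fixes the branch,
  without which the error on the right edge would not be small.\<close>

lemma holomorphic_log_dirichlet_L:
  assumes GRH
  obtains g where "g holomorphic_on {s. Re s > 1/2}"
    "\<And>s. Re s > 1/2 \<Longrightarrow> exp (g s) = dirichlet_L chi s"
    "\<And>s. Re s \<ge> 3/2 \<Longrightarrow> g s = (\<Sum>n. logL_term n s)"
proof -
  have "contractible {s. Re s > 1/2}"
    by (intro convex_imp_contractible convex_halfspace_Re_gt)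
  then obtain g0 where g0: "g0 holomorphic_on {s. Re s > 1/2}"
    "\<And>s. s \<in> {s. Re s > 1/2} \<Longrightarrow> dirichlet_L chi s = exp (g0 s)"
    using contractible_imp_holomorphic_log[OF holomorphic_dirichlet_L] dirichlet_L_nonzero[OF assms]
    by (metis mem_Collect_eq)
  define K where "K = {s. Re s \<ge> 3/2}"
  define d where "d = (\<lambda>s. g0 s - (\<Sum>n. logL_term n s))"
  have exp_d: "exp (d s) = 1" if "s \<in> K" for s
    using that g0(2)[of s] exp_logL[of s] dirichlet_L_nonzero[OF assms, of s]
    by (simp add: d_def K_def exp_diff)
  have "d constant_on K"
  proof (rule continuous_discrete_range_constant)
    show "connected K" unfolding K_def by (intro convex_connected convex_halfspace_Re_ge)
    show "continuous_on K d"
      unfolding d_def K_def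
      by (intro continuous_on_diff continuous_logL continuous_on_subset[OF holomorphic_on_imp_continuous_on[OF g0(1)]]) auto
    fix x assume x: "x \<in> K"
    have "1 \<le> norm (d y - d x)" if y: "y \<in> K" "d y \<noteq> d x" for y
    proof -
      have "exp (d y) = exp (d x)" using exp_d x y by simp
      then obtain n :: int where n: "d y = d x + of_int (2 * n) * of_real pi * \<i>"
        by (auto simp: exp_eq)
      then have "n \<noteq> 0" using y by auto
      have "norm (d y - d x) = \<bar>2 * real_of_int n\<bar> * pi" using n by (simp add: norm_mult)
      moreover have "1 * 1 \<le> \<bar>2 * real_of_int n\<bar> * pi"
        using \<open>n \<noteq> 0\<close> pi_gt3 by (intro mult_mono) auto
      ultimately show ?thesis by simp
    qed
    then show "\<exists>e>0. \<forall>y. y \<in> K \<and> d y \<noteq> d x \<longrightarrow> e \<le> norm (d y - d x)"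
      by (intro exI[of _ 1]) auto
  qed
  then obtain c where c: "\<And>s. s \<in> K \<Longrightarrow> d s = c" by (auto simp: constant_on_def)
  have "exp c = 1" using c[of 2] exp_d[of 2] by (simp add: K_def)
  show ?thesis
  proof (rule that[of "\<lambda>s. g0 s - c"])
    show "(\<lambda>s. g0 s - c) holomorphic_on {s. Re s > 1/2}" by (intro holomorphic_intros g0)
    show "exp (g0 s - c) = dirichlet_L chi s" if "Re s > 1/2" for s
      using g0(2)[of s] that \<open>exp c = 1\<close> by (simp add: exp_diff)
    show "g0 s - c = (\<Sum>n. logL_term n s)" if "Re s \<ge> 3/2" for s
      using c[of s] that by (auto simp: K_def d_def)
  qed
qed

end

section \<open>Borel--Caratheodory and weighted Chebyshev bounds\<close>

text \<open>Schwarz's lemma for f / (2A - f): a point with real part below A is closer to 0 than to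
  2A, so the quotient maps the disc into itself. Solving for f gives the bound.\<close>

lemma Borel_Caratheodory_unit_ball:
  assumes holf: "f holomorphic_on ball 0 1" and f0: "f 0 = 0"
    and A: "\<And>z. norm z < 1 \<Longrightarrow> Re (f z) < A" and z: "norm z < 1"
  shows "norm (f z) \<le> 2 * A * norm z / (1 - norm z)"
proof -
  have A0: "A > 0" using A[of 0] f0 by simp
  define \<phi> where "\<phi> = (\<lambda>w. f w / (of_real (2 * A) - f w))"
  have nz: "of_real (2 * A) - f w \<noteq> 0" if "norm w < 1" for w
    using A[OF that] A0 by (auto simp: complex_eq_iff)
  have "norm (\<phi> z) \<le> norm z"
  proof (rule Schwarz_Lemma)
    show "\<phi> holomorphic_on ball 0 1"
      unfolding \<phi>_def using nz by (intro holomorphic_intros holf) auto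
    show "\<phi> 0 = 0" by (simp add: \<phi>_def f0)
    show "norm (\<phi> w) < 1" if w: "norm w < 1" for w
    proof -
      have "norm (of_real (2 * A) - f w) ^ 2 - norm (f w) ^ 2 = 4 * A * (A - Re (f w))"
        by (simp add: cmod_power2) (simp add: power2_eq_square algebra_simps)
      also have "\<dots> > 0" using A[OF w] A0 by simp
      finally have "norm (f w) < norm (of_real (2 * A) - f w)"
        by (intro power2_less_imp_less[of "norm (f w)"]) auto
      then show ?thesis using nz[OF w] by (simp add: \<phi>_def norm_divide)
    qed
  qed (use z in auto)
  moreover have "f z * (1 + \<phi> z) = of_real (2 * A) * \<phi> z"
    using nz[OF z] by (simp add: \<phi>_def field_simps)
  then have "norm (f z) * norm (1 + \<phi> z) = 2 * A * norm (\<phi> z)"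
    using A0 by (metis norm_mult norm_of_real abs_of_pos mult_pos_pos zero_less_numeral)
  moreover have "1 - norm z \<le> norm (1 + \<phi> z)"
    using norm_triangle_ineq2[of 1 "- \<phi> z"] \<open>norm (\<phi> z) \<le> norm z\<close> by simp
  ultimately have "norm (f z) * (1 - norm z) \<le> 2 * A * norm (\<phi> z)"
    using mult_left_mono[of "1 - norm z" "norm (1 + \<phi> z)" "norm (f z)"] by simp
  also have "\<dots> \<le> 2 * A * norm z" using \<open>norm (\<phi> z) \<le> norm z\<close> A0 by simp
  finally have "norm (f z) * (1 - norm z) \<le> 2 * A * norm z" .
  then show ?thesis using z by (simp add: field_simps)
qed

lemma Borel_Caratheodory:
  assumes holg: "g holomorphic_on ball c R"
    and A: "\<And>w. w \<in> ball c R \<Longrightarrow> Re (g w - g c) < A" and z: "z \<in> ball c R"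
  shows "norm (g z - g c) \<le> 2 * A * dist c z / (R - dist c z)"
proof -
  have R: "R > 0" using z by (metis ball_eq_empty empty_iff not_le)
  define f where "f = (\<lambda>w. g (c + of_real R * w) - g c)"
  have in_ball: "c + of_real R * w \<in> ball c R" if "norm w < 1" for w
    using that R by (simp add: dist_norm norm_mult)
  define w where "w = (z - c) / of_real R"
  have nw: "norm w = dist c z / R" using R by (simp add: w_def norm_divide dist_norm norm_minus_commute)
  have "norm (f w) \<le> 2 * A * norm w / (1 - norm w)"
  proof (rule Borel_Caratheodory_unit_ball)
    have "(g \<circ> (\<lambda>w. c + of_real R * w)) holomorphic_on ball 0 1"
      using in_ball by (intro holomorphic_on_compose_gen[OF _ holg] holomorphic_intros) auto
    then show "f holomorphic_on ball 0 1" unfolding f_def o_def by (intro holomorphic_intros)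
    show "Re (f u) < A" if "norm u < 1" for u
      unfolding f_def using A[OF in_ball[OF that]] .
    show "norm w < 1" unfolding nw using z R by simp
  qed (simp add: f_def)
  moreover have "f w = g z - g c" using R by (simp add: f_def w_def)
  moreover have "2 * A * norm w / (1 - norm w) = 2 * A * dist c z / (R - dist c z)"
    using R z unfolding nw by (simp add: field_simps)
  ultimately show ?thesis by simp
qed

text \<open>Summation by parts carries Chebyshev's bound over to decreasing weights, as if \<Lambda>
  were at most 4 everywhere.\<close>

lemma sum_mangoldt_weighted_le:
  fixes w :: "nat \<Rightarrow> real"
  assumes dec: "\<And>m n. 1 \<le> m \<Longrightarrow> m \<le> n \<Longrightarrow> w n \<le> w m" and nn: "\<And>n. w n \<ge> 0"
  shows "(\<Sum>n=1..N. mangoldt n * w n) \<le> 4 * (\<Sum>n=1..N. w n)"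
proof -
  have eq: "(\<Sum>n=1..N. a n * w n) = (\<Sum>k=1..<N. (\<Sum>n=1..k. a n) * (w k - w (Suc k))) + (\<Sum>n=1..N. a n) * w N"
    if "N \<ge> 1" for a :: "nat \<Rightarrow> real" and N
    using that by (induction N rule: nat_induct_at_least) (auto simp: algebra_simps sum.atLeastLessThan_Suc)
  have le: "(\<Sum>n=1..k. mangoldt n :: real) \<le> (\<Sum>n=1..k. 4)" for k
  proof -
    have "(\<Sum>n=1..k. mangoldt n :: real) = (\<Sum>n\<le>k. mangoldt n)"
      by (rule sum.mono_neutral_left) (auto simp: Suc_le_eq)
    then show ?thesis using sum_mangoldt_le[of k] by simp
  qed
  show ?thesis
  proof (cases "N \<ge> 1")
    case True
    have "(\<Sum>n=1..N. mangoldt n * w n) \<le> (\<Sum>n=1..N. 4 * w n)"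
      unfolding eq[OF True]
      by (intro add_mono sum_mono mult_right_mono le) (use dec nn in auto)
    then show ?thesis by (simp add: sum_distrib_left)
  qed (use nn in auto)
qed

lemma sum_powr_le:
  fixes \<eta> :: real
  assumes "0 < \<eta>" "\<eta> \<le> 1"
  shows "(\<Sum>n=1..N. real n powr (\<eta> - 1)) \<le> real N powr \<eta> / \<eta>"
proof (induction N)
  case (Suc N)
  have "\<eta> * real (Suc N) powr (\<eta> - 1) \<le> real (Suc N) powr \<eta> - real N powr \<eta>"
  proof (cases "N = 0")
    case False
    obtain z where z: "real N < z" "z < real N + 1"
      "real N powr (-(-\<eta>)) - (real N + 1) powr (-(-\<eta>)) = (-\<eta>) * z powr (-(-\<eta>) - 1)"
      using powr_neg_diff[of "real N" "-\<eta>"] False by auto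
    have "real (Suc N) powr (\<eta> - 1) \<le> z powr (\<eta> - 1)"
      using z assms False by (intro powr_mono2') auto
    then have "\<eta> * real (Suc N) powr (\<eta> - 1) \<le> \<eta> * z powr (\<eta> - 1)"
      using assms by simp
    then show ?thesis using z(3) by (simp add: add.commute)
  qed (use assms in auto)
  then have "real (Suc N) powr (\<eta> - 1) \<le> (real (Suc N) powr \<eta> - real N powr \<eta>) / \<eta>"
    using assms by (simp add: field_simps)
  then show ?case using Suc by (simp add: diff_divide_distrib del: of_nat_Suc)
qed auto

text \<open>Majorant of the short sum on the left edge Re s = 1 - \<eta>.\<close>

definition primepow_head :: "real \<Rightarrow> nat \<Rightarrow> real" where
  "primepow_head \<eta> N = (\<Sum>n=1..N. primepow_weight n * real n powr (\<eta> - 1))"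

text \<open>Majorant of the omitted terms on the right edge Re s = 2.\<close>

definition primepow_tail :: "nat \<Rightarrow> real" where
  "primepow_tail N = (\<Sum>n. primepow_weight (n + Suc N) * real (n + Suc N) powr (-2))"

text \<open>With w \<le> 1 alone the product would only be bounded. Up to sqrt N this suffices, as n
  powr (\<eta>/2) \<le> N powr (\<eta>/4) there; beyond sqrt N, ln n \<ge> (ln N) / 2 gives w \<le>
  2 \<Lambda> / ln N, and Chebyshev's bound gains the logarithm. Adding both estimates termwise
  avoids splitting the sum.\<close>

lemma primepow_head_tendsto:
  assumes "0 < \<eta>" "\<eta> \<le> 1"
  shows "(\<lambda>N. real N powr (-\<eta>) * primepow_head \<eta> N) \<longlonglongrightarrow> 0"
proof (rule tendsto_sandwich[of "\<lambda>_. 0"])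
  show "(\<lambda>N. real N powr (-\<eta>) * (real N powr (\<eta>/4) * (real N powr (\<eta>/2) / (\<eta>/2)) + 2 / ln (real N) * (4 * (real N powr \<eta> / \<eta>)))) \<longlonglongrightarrow> 0"
    using assms by real_asymp
  show "eventually (\<lambda>N. real N powr (-\<eta>) * primepow_head \<eta> N \<le>
    real N powr (-\<eta>) * (real N powr (\<eta>/4) * (real N powr (\<eta>/2) / (\<eta>/2)) + 2 / ln (real N) * (4 * (real N powr \<eta> / \<eta>)))) sequentially"
    using eventually_ge_at_top[of 2]
  proof eventually_elim
    case (elim N)
    have lnN: "ln (real N) > 0" using elim by simp
    have "primepow_head \<eta> N \<le> (\<Sum>n=1..N. real N powr (\<eta>/4) * real n powr (\<eta>/2 - 1) + 2 / ln (real N) * (mangoldt n * real n powr (\<eta> - 1)))"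
      unfolding primepow_head_def
    proof (rule sum_mono)
      fix n assume n: "n \<in> {1..N}"
      have nonneg1: "0 \<le> real N powr (\<eta>/4) * real n powr (\<eta>/2 - 1)" by simp
      have nonneg2: "0 \<le> 2 / ln (real N) * (mangoldt n * real n powr (\<eta> - 1))"
        using lnN by (simp add: mangoldt_nonneg)
      show "primepow_weight n * real n powr (\<eta> - 1) \<le> real N powr (\<eta>/4) * real n powr (\<eta>/2 - 1) + 2 / ln (real N) * (mangoldt n * real n powr (\<eta> - 1))"
      proof (cases "n ^ 2 \<le> N")
        case True
        have "primepow_weight n * real n powr (\<eta> - 1) \<le> real n powr (\<eta> - 1)"
          by (intro mult_left_le_one_le primepow_weight_nonneg primepow_weight_le_1) auto
        also have "\<dots> = real n powr (\<eta>/2) * real n powr (\<eta>/2 - 1)"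
          by (simp add: powr_add[symmetric])
        also have "real n powr (\<eta>/2) = (real n ^ 2) powr (\<eta>/4)"
          using n powr_powr[of "real n" 2 "\<eta>/4"] by (simp add: powr_numeral)
        also have "(real n ^ 2) powr (\<eta>/4) \<le> real N powr (\<eta>/4)"
          using True assms by (intro powr_mono2) (auto simp flip: of_nat_power)
        finally show ?thesis using nonneg2 by (simp add: mult_right_mono)
      next
        case False
        then have "real N \<le> real n ^ 2" by (simp flip: of_nat_power)
        then have "ln (real N) \<le> ln (real n ^ 2)" using elim n by (intro ln_mono) auto
        then have ln: "ln (real N) \<le> 2 * ln (real n)" using n by (simp add: ln_realpow)
        have "primepow_weight n \<le> 2 / ln (real N) * mangoldt n"
        proof -
          have "mangoldt n * (1 / ln (real n)) \<le> mangoldt n * (2 / ln (real N))"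
            using ln lnN by (intro mult_left_mono mangoldt_nonneg) (auto simp: field_simps)
          then show ?thesis by (simp add: primepow_weight_def mult.commute)
        qed
        then have "primepow_weight n * real n powr (\<eta> - 1) \<le> 2 / ln (real N) * mangoldt n * real n powr (\<eta> - 1)"
          by (rule mult_right_mono) auto
        then show ?thesis using nonneg1 unfolding mult.assoc by linarith
      qed
    qed
    also have "\<dots> = real N powr (\<eta>/4) * (\<Sum>n=1..N. real n powr (\<eta>/2 - 1)) + 2 / ln (real N) * (\<Sum>n=1..N. mangoldt n * real n powr (\<eta> - 1))"
      by (simp add: sum.distrib sum_distrib_left)
    also have "\<dots> \<le> real N powr (\<eta>/4) * (real N powr (\<eta>/2) / (\<eta>/2)) + 2 / ln (real N) * (4 * (real N powr \<eta> / \<eta>))"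
    proof (intro add_mono mult_left_mono)
      show "(\<Sum>n=1..N. real n powr (\<eta>/2 - 1)) \<le> real N powr (\<eta>/2) / (\<eta>/2)"
        using assms by (intro sum_powr_le) auto
      have "(\<Sum>n=1..N. mangoldt n * real n powr (\<eta> - 1)) \<le> 4 * (\<Sum>n=1..N. real n powr (\<eta> - 1))"
        using assms by (intro sum_mangoldt_weighted_le powr_mono2') auto
      also have "\<dots> \<le> 4 * (real N powr \<eta> / \<eta>)"
        using sum_powr_le[OF assms, of N] by simp
      finally show "(\<Sum>n=1..N. mangoldt n * real n powr (\<eta> - 1)) \<le> 4 * (real N powr \<eta> / \<eta>)" .
    qed (use lnN in auto)
    finally show ?case by (intro mult_left_mono) auto
  qed
  show "eventually (\<lambda>N. 0 \<le> real N powr (-\<eta>) * primepow_head \<eta> N) sequentially"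
    unfolding primepow_head_def
    by (intro always_eventually allI mult_nonneg_nonneg sum_nonneg primepow_weight_nonneg) auto
qed auto

lemma summable_primepow_tail: "summable (\<lambda>n. primepow_weight (n + Suc N) * real (n + Suc N) powr (-2))"
proof -
  have "summable (\<lambda>n. primepow_weight n * real n powr (-2))"
    by (rule summable_comparison_test'[of "\<lambda>n. real n powr (-2)" 0])
      (auto simp: summable_real_powr_iff abs_mult primepow_weight_nonneg
            intro!: mult_left_le_one_le primepow_weight_le_1)
  then show ?thesis by (subst summable_iff_shift)
qed

lemma primepow_tail_nonneg: "primepow_tail N \<ge> 0"
  unfolding primepow_tail_def
  by (intro suminf_nonneg summable_primepow_tail mult_nonneg_nonneg primepow_weight_nonneg) auto

lemma primepow_tail_le:
  assumes "N \<ge> 2"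
  shows "real N * primepow_tail N \<le> 8 / ln (real N)"
proof -
  have lnN: "ln (real N) > 0" using assms by simp
  \<comment> \<open>Constant up to N, so that the weight decreases from n = 1 on and the Chebyshev
    bound applies. The first N terms cost N * N^-2 = 1 / N, as much as the tail itself, hence 8 = 4
    + 4.\<close>
  define w where "w = (\<lambda>n. real (max n N) powr (-(1 + 1)))"
  note tail = powr_tail_le[of 1 N]
  have "primepow_tail N \<le> 8 / (real N * ln (real N))"
    unfolding primepow_tail_def
  proof (rule suminf_le_const[OF summable_primepow_tail])
    fix M
    have "(\<Sum>n<M. primepow_weight (n + Suc N) * real (n + Suc N) powr (-2))
        \<le> (\<Sum>n<M. 1 / ln (real N) * (mangoldt (n + Suc N) * w (n + Suc N)))"
    proof (rule sum_mono)
      fix n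
      have "mangoldt (n + Suc N) / ln (real (n + Suc N)) \<le> mangoldt (n + Suc N) / ln (real N)"
        using assms lnN by (intro divide_left_mono mangoldt_nonneg mult_pos_pos) auto
      then have "primepow_weight (n + Suc N) * real (n + Suc N) powr (-2) \<le> mangoldt (n + Suc N) / ln (real N) * real (n + Suc N) powr (-2)"
        unfolding primepow_weight_def by (rule mult_right_mono) auto
      moreover have "w (n + Suc N) = real (n + Suc N) powr (-2)" by (simp add: w_def max_def)
      ultimately show "primepow_weight (n + Suc N) * real (n + Suc N) powr (-2) \<le> 1 / ln (real N) * (mangoldt (n + Suc N) * w (n + Suc N))"
        by (simp add: field_simps)
    qed
    also have "\<dots> = 1 / ln (real N) * (\<Sum>n<M. mangoldt (n + Suc N) * w (n + Suc N))"
      by (simp add: sum_distrib_left)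
    also have "(\<Sum>n<M. mangoldt (n + Suc N) * w (n + Suc N)) = (\<Sum>n\<in>{N<..N+M}. mangoldt n * w n)"
      by (rule sum.reindex_bij_witness[of _ "\<lambda>n. n - Suc N" "\<lambda>n. n + Suc N"]) auto
    also have "\<dots> \<le> (\<Sum>n=1..N+M. mangoldt n * w n)"
      by (rule sum_mono2) (auto intro!: mult_nonneg_nonneg mangoldt_nonneg simp: w_def)
    also have "\<dots> \<le> 4 * (\<Sum>n=1..N+M. w n)"
      using assms by (intro sum_mangoldt_weighted_le) (auto simp: w_def intro!: powr_mono2')
    also have "(\<Sum>n=1..N+M. w n) = (\<Sum>n=1..N. w n) + (\<Sum>n\<in>{N<..N+M}. w n)"
      by (subst sum.union_disjoint[symmetric]) (auto intro!: sum.cong)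
    also have "(\<Sum>n=1..N. w n) = 1 / real N"
    proof -
      have "(\<Sum>n=1..N. w n) = (\<Sum>n=1..N. real N powr (-2))"
        by (intro sum.cong) (auto simp: w_def max_def)
      also have "\<dots> = 1 / real N"
        using assms by (simp add: powr_minus powr_numeral power2_eq_square field_simps)
      finally show ?thesis .
    qed
    also have "(\<Sum>n\<in>{N<..N+M}. w n) = (\<Sum>n<M. real (n + Suc N) powr (-(1 + 1)))"
      by (rule sum.reindex_bij_witness[of _ "\<lambda>n. n + Suc N" "\<lambda>n. n - Suc N"]) (auto simp: w_def max_def)
    also have "\<dots> \<le> (\<Sum>n. real (n + Suc N) powr (-(1 + 1)))"
      using assms by (intro sum_le_suminf tail(1)) auto
    also have "\<dots> \<le> real N powr (-1) / 1" using assms by (intro tail(2)) auto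
    also have "real N powr (-1) / 1 = 1 / real N" using assms by (simp add: powr_minus divide_inverse)
    finally show "(\<Sum>n<M. primepow_weight (n + Suc N) * real (n + Suc N) powr (-2)) \<le> 8 / (real N * ln (real N))"
      using lnN by (simp add: field_simps)
  qed
  then have "real N * primepow_tail N \<le> real N * (8 / (real N * ln (real N)))"
    by (rule mult_left_mono) auto
  then show ?thesis using assms by simp
qed

section \<open>Approximation by a short sum over prime powers\<close>

lemma Re_ge_if_cube_root_unity:
  fixes z :: complex
  assumes "z ^ 3 = 1"
  shows "Re z \<ge> -1/2"
proof (cases "z = 1")
  case False
  have "(z - 1) * (z ^ 2 + z + 1) = z ^ 3 - 1"
    by (simp add: algebra_simps power2_eq_square power3_eq_cube)
  then have eq: "z ^ 2 + z + 1 = 0" using assms False by simp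
  have "Im z * (2 * Re z + 1) = 0"
    using arg_cong[OF eq, of Im] by (simp add: power2_eq_square algebra_simps)
  moreover have "Im z \<noteq> 0"
  proof
    assume "Im z = 0"
    then have "(Re z)\<^sup>2 + Re z + 1 = 0"
      using arg_cong[OF eq, of Re] by (simp add: power2_eq_square)
    moreover have "(Re z)\<^sup>2 + Re z + 1 = (Re z + 1/2)\<^sup>2 + 3/4"
      by (simp add: power2_eq_square algebra_simps)
    ultimately show False using zero_le_power2[of "Re z + 1/2"] by linarith
  qed
  ultimately show ?thesis by simp
qed auto

lemma primepow_weight_cube: "primepow_weight (m ^ 3) = primepow_weight m / 3"
proof (cases "primepow m")
  case True
  then obtain p k where "prime p" "m = p ^ k" unfolding primepow_def by auto
  then show ?thesis by (simp add: primepow_weight_prime_power power_mult[symmetric] mult.commute)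
next
  case False
  then have "\<not> primepow (m ^ 3)" by (cases "m = 0") (auto simp: primepow_power_iff_nat)
  then show ?thesis using False by (simp add: primepow_weight_eq_0)
qed

text \<open>A truncation of ln \<zeta>(3). The cut is at \<open>m ^ 3 \<le> N\<close> because w(n) /
  n at the cube n = m^3 is one third of w(m) / m^3.\<close>

definition primepow_cubes :: "nat \<Rightarrow> real" where
  "primepow_cubes N = (\<Sum>m | m ^ 3 \<le> N. primepow_weight m / real m ^ 3)"

lemma cubes_le_subset: "{m. m ^ 3 \<le> N} \<subseteq> {..N::nat}"
proof
  fix m assume m: "m \<in> {m. m ^ 3 \<le> N}"
  have "m \<le> m ^ 3" by (cases "m = 0") (auto simp: self_le_power)
  then show "m \<in> {..N}" using m by simp
qed

lemma zeta3_eq: "ln zeta3 = (\<Sum>n. primepow_weight n / real n ^ 3)" "zeta3 > 0"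
  and summable_primepow_weight_cubes: "summable (\<lambda>n. primepow_weight n / real n ^ 3)"
proof -
  have s: "summable (\<lambda>n. 1 / real n ^ 3)"
    using inverse_power_summable[of 3, where 'a = real] by (simp add: inverse_eq_divide)
  have "exp (\<Sum>n. primepow_weight n * (1 / real n ^ 3)) = (\<Sum>n. 1 / real n ^ 3)"
    by (rule exp_primepow_weight_series_real) (use s in \<open>auto simp: power_mult_distrib\<close>)
  moreover have "(\<Sum>n. 1 / real n ^ 3) = zeta3"
    using suminf_split_head[OF s] by (simp add: zeta3_def)
  ultimately have "exp (\<Sum>n. primepow_weight n / real n ^ 3) = zeta3" by simp
  then show "ln zeta3 = (\<Sum>n. primepow_weight n / real n ^ 3)" "zeta3 > 0"
    by (metis ln_exp, metis exp_gt_zero)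
  show "summable (\<lambda>n. primepow_weight n / real n ^ 3)"
    by (rule summable_comparison_test'[OF s, of 0])
      (auto simp: primepow_weight_nonneg primepow_weight_le_1 intro!: divide_right_mono)
qed

lemma primepow_cubes_asymp_ge:
  assumes "e > 0"
  shows "eventually (\<lambda>N. ln zeta3 - e \<le> primepow_cubes N) sequentially"
proof -
  have "(\<lambda>M. \<Sum>n<M. primepow_weight n / real n ^ 3) \<longlonglongrightarrow> ln zeta3"
    unfolding zeta3_eq by (rule summable_LIMSEQ[OF summable_primepow_weight_cubes])
  then have "eventually (\<lambda>M. ln zeta3 - e < (\<Sum>n<M. primepow_weight n / real n ^ 3)) sequentially"
    using assms by (intro order_tendstoD(1)) auto
  then obtain M where M: "ln zeta3 - e < (\<Sum>n<M. primepow_weight n / real n ^ 3)"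
    by (auto simp: eventually_sequentially)
  show ?thesis
    using eventually_ge_at_top[of "M ^ 3"]
  proof eventually_elim
    case (elim N)
    have "m ^ 3 \<le> N" if "m < M" for m
      using that elim power_mono[of m M 3] by linarith
    then have "(\<Sum>n<M. primepow_weight n / real n ^ 3) \<le> primepow_cubes N"
      unfolding primepow_cubes_def
      by (intro sum_mono2 finite_subset[OF cubes_le_subset] divide_nonneg_nonneg primepow_weight_nonneg) auto
    then show ?case using M by simp
  qed
qed

context cubic_char
begin

lemma Re_logL_term_1: "Re (logL_term n 1) = primepow_weight n / real n * Re (chi n)"
proof -
  have "logL_term n 1 = of_real (primepow_weight n / real n) * chi n"
    by (cases "n = 0") (auto simp: logL_term_def powr_minus divide_inverse)
  then show ?thesis by (simp only: Re_complex_of_real Im_complex_of_real times_complex.sel)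
qed

lemma Re_sum_logL_le: "Re (\<Sum>n\<le>N. logL_term n 1) \<le> primepow_harm N"
  unfolding Re_sum primepow_harm_def
proof (rule sum_mono)
  fix n
  have "Re (chi n) \<le> 1" using complex_Re_le_cmod[of "chi n"] norm_chi_le_1[of n] by linarith
  then show "Re (logL_term n 1) \<le> primepow_weight n / real n"
    unfolding Re_logL_term_1 by (intro mult_left_le) (auto simp: primepow_weight_nonneg)
qed

text \<open>Terms with \<open>n\<close> not coprime to \<open>q\<close> vanish in the sum, whereas in the lower bound they contribute a
  nonpositive total, since \<open>m\<^sup>3 \<le> N\<close> implies \<open>m \<le> N\<close> and \<open>w(m) / m\<^sup>3 \<le> w(m) / m\<close>.\<close>

lemma Re_sum_logL_ge: "Re (\<Sum>n\<le>N. logL_term n 1) \<ge> (primepow_cubes N - primepow_harm N) / 2"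
proof -
  define a where "a = (\<lambda>n. primepow_weight n / real n)"
  define C where "C = {m. m ^ 3 \<le> N}"
  have a0: "a n \<ge> 0" for n by (simp add: a_def primepow_weight_nonneg)
  have C: "finite C" "C \<subseteq> {..N}"
    using cubes_le_subset[of N] finite_subset[OF cubes_le_subset] by (auto simp: C_def)
  have cop3: "coprime (m ^ 3) q \<longleftrightarrow> coprime m q" for m by simp
  have inj: "inj_on (\<lambda>m::nat. m ^ 3) A" for A by (auto intro!: inj_onI simp: power_eq_iff_eq_base)
  \<comment> \<open>One formula for three lower bounds of Re \<chi>(n): 0 if n is not coprime to q,
    1 at coprime cubes, -1/2 otherwise. The factor 3/2 will meet w(m^3) = w(m) / 3, which leaves
    half of \<open>primepow_cubes\<close>.\<close>
  have "(\<Sum>n\<le>N. -1/2 * a n + 1/2 * (if coprime n q then 0 else a n) + 3/2 * (if coprime n q \<and> n \<in> range (\<lambda>m. m ^ 3) then a n else 0))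
      \<le> (\<Sum>n\<le>N. Re (logL_term n 1))"
  proof (rule sum_mono)
    fix n
    show "-1/2 * a n + 1/2 * (if coprime n q then 0 else a n) + 3/2 * (if coprime n q \<and> n \<in> range (\<lambda>m. m ^ 3) then a n else 0) \<le> Re (logL_term n 1)"
    proof (cases "coprime n q")
      case False
      then show ?thesis using chi_eq_0_iff[of n] by (simp add: Re_logL_term_1)
    next
      case cop: True
      show ?thesis
      proof (cases "n \<in> range (\<lambda>m. m ^ 3)")
        case True
        then obtain m where m: "n = m ^ 3" by auto
        then have "chi n = chi m ^ 3" by (simp add: power3_eq_cube chi_mult)
        then have "chi n = 1" using chi_cube[of m] cop m cop3 by simp
        then show ?thesis using cop True by (simp add: Re_logL_term_1 a_def)
      next
        case False
        have "Re (chi n) \<ge> -1/2" using chi_cube[of n] cop by (intro Re_ge_if_cube_root_unity) simp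
        then have "a n * (-1/2) \<le> a n * Re (chi n)" by (rule mult_left_mono) (rule a0)
        then show ?thesis using False cop by (simp add: Re_logL_term_1 a_def)
      qed
    qed
  qed
  moreover have "(\<Sum>n\<le>N. if coprime n q \<and> n \<in> range (\<lambda>m. m ^ 3) then a n else 0)
      = (\<Sum>m\<in>C. if coprime m q then primepow_weight m / real m ^ 3 else 0) / 3"
  proof -
    have "(\<Sum>n\<le>N. if coprime n q \<and> n \<in> range (\<lambda>m. m ^ 3) then a n else 0)
        = (\<Sum>n\<in>(\<lambda>m. m ^ 3) ` C. if coprime n q then a n else 0)"
      by (rule sum.mono_neutral_cong_right) (auto simp: C_def)
    also have "\<dots> = (\<Sum>m\<in>C. if coprime m q then a (m ^ 3) else 0)"
      by (subst sum.reindex[OF inj]) simp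
    also have "\<dots> = (\<Sum>m\<in>C. if coprime m q then primepow_weight m / real m ^ 3 else 0) / 3"
      unfolding sum_divide_distrib by (intro sum.cong) (auto simp: a_def primepow_weight_cube)
    finally show ?thesis .
  qed
  moreover have "(\<Sum>m\<in>C. if coprime m q then 0 else primepow_weight m / real m ^ 3) \<le> (\<Sum>n\<le>N. if coprime n q then 0 else a n)"
  proof (rule order.trans)
    show "(\<Sum>m\<in>C. if coprime m q then 0 else primepow_weight m / real m ^ 3) \<le> (\<Sum>m\<in>C. if coprime m q then 0 else a m)"
    proof (rule sum_mono)
      fix m
      have "primepow_weight m / real m ^ 3 \<le> a m"
      proof (cases "m = 0")
        case False
        have "real m \<le> real m ^ 3" using False by (intro self_le_power) auto
        then show ?thesis unfolding a_def using False
          by (intro divide_left_mono primepow_weight_nonneg) auto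
      qed (simp add: a_def)
      then show "(if coprime m q then 0 else primepow_weight m / real m ^ 3) \<le> (if coprime m q then 0 else a m)" by simp
    qed
    show "(\<Sum>m\<in>C. if coprime m q then 0 else a m) \<le> (\<Sum>n\<le>N. if coprime n q then 0 else a n)"
      using C a0 by (intro sum_mono2) auto
  qed
  moreover have "primepow_cubes N = (\<Sum>m\<in>C. if coprime m q then primepow_weight m / real m ^ 3 else 0)
      + (\<Sum>m\<in>C. if coprime m q then 0 else primepow_weight m / real m ^ 3)"
    unfolding primepow_cubes_def C_def[symmetric] sum.distrib[symmetric] by (intro sum.cong) auto
  moreover have "primepow_harm N = (\<Sum>n\<le>N. a n)" by (simp add: primepow_harm_def a_def)
  moreover have "(K - H) / 2 \<le> R"
    if "-1/2 * A + 1/2 * B + 3/2 * X \<le> R" "X = C1 / 3" "C2 \<le> B" "K = C1 + C2" "H = A"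
    for A B X R C1 C2 K H :: real
    using that by (auto simp: field_simps)
  ultimately show ?thesis
    unfolding Re_sum sum.distrib sum_distrib_left[symmetric] by blast
qed

text \<open>Borel--Caratheodory on the disc of radius 3/2 around 2 + it, which touches Re s = 1/2,
  while s stays \<delta> away from its boundary circle. The input is an upper bound for Re g = ln
  |L|, and there the factor q of the crude bound becomes ln q.\<close>

lemma norm_log_dirichlet_L_le:
  assumes holg: "g holomorphic_on {s. Re s > 1/2}"
    and expg: "\<And>s. Re s > 1/2 \<Longrightarrow> exp (g s) = dirichlet_L chi s"
    and g_eq: "\<And>s. Re s \<ge> 3/2 \<Longrightarrow> g s = (\<Sum>n. logL_term n s)"
    and s: "\<delta> > 0" "1/2 + \<delta> \<le> Re s" "Re s \<le> 2"
  shows "norm (g s) \<le> 1 + 3 * (ln (real q) + 13 + 3 * \<bar>Im s\<bar>) / \<delta>"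
proof -
  define t where "t = Im s"
  define c where "c = Complex 2 t"
  \<comment> \<open>13 leaves room: Re g is at most ln q + 21/2 + 3 |t| on the disc, and 1 bounds g
    at the centre.\<close>
  define A where "A = ln (real q) + 13 + 3 * \<bar>t\<bar>"
  have gc: "norm (g c) \<le> 1" using g_eq[of c] norm_logL_le[of c] by (simp add: c_def)
  have ball: "Re w > 1/2" "norm w < \<bar>t\<bar> + 7/2" if "w \<in> ball c (3/2)" for w
  proof -
    have "\<bar>Re (w - c)\<bar> \<le> norm (w - c)" by (rule abs_Re_le_cmod)
    moreover have d: "norm (w - c) < 3/2" using that by (simp add: dist_norm norm_minus_commute)
    ultimately show "Re w > 1/2" by (simp add: c_def)
    have "norm c \<le> 2 + \<bar>t\<bar>" using cmod_le[of c] by (simp add: c_def)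
    then show "norm w < \<bar>t\<bar> + 7/2" using d norm_triangle_sub[of w c] by linarith
  qed
  have dist: "dist c s = 2 - Re s"
  proof -
    have "c - s = of_real (2 - Re s)" by (simp add: c_def t_def complex_eq_iff)
    then show ?thesis using s unfolding dist_norm by (simp only: norm_of_real)
  qed
  have lnq: "ln (real q) \<ge> 0" using q_gt_1 by simp
  then have A0: "A \<ge> 0" by (simp add: A_def)
  have "norm (g s - g c) \<le> 2 * A * dist c s / (3/2 - dist c s)"
  proof (rule Borel_Caratheodory)
    show "g holomorphic_on ball c (3/2)"
      by (rule holomorphic_on_subset[OF holg]) (use ball in auto)
    show "s \<in> ball c (3/2)" using s dist by simp
    fix w assume w: "w \<in> ball c (3/2)"
    have "exp (Re (g w)) = norm (dirichlet_L chi w)" using expg[OF ball(1)[OF w]] by (metis norm_exp_eq_Re)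
    also have "\<dots> \<le> real q * (1 + 3 * norm w)" using ball(1)[OF w] by (intro norm_dirichlet_L_le) simp
    also have "\<dots> \<le> real q * (23/2 + 3 * \<bar>t\<bar>)" using ball(2)[OF w] by (intro mult_left_mono) auto
    finally have "Re (g w) \<le> ln (real q * (23/2 + 3 * \<bar>t\<bar>))"
      using q_pos by (subst ln_ge_iff) (auto intro!: mult_pos_pos add_pos_nonneg)
    also have "\<dots> = ln (real q) + ln (23/2 + 3 * \<bar>t\<bar>)"
      using q_pos by (subst ln_mult) (auto intro!: add_pos_nonneg)
    \<comment> \<open>Wasteful, but linear growth in |t| is harmless against the later factor exp
      (z^2).\<close>
    also have "ln (23/2 + 3 * \<bar>t\<bar>) \<le> (23/2 + 3 * \<bar>t\<bar>) - 1"
      by (rule ln_le_minus_one) auto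
    finally have "Re (g w) \<le> ln (real q) + 21/2 + 3 * \<bar>t\<bar>" by simp
    moreover have "- Re (g c) \<le> 1" using gc abs_Re_le_cmod[of "g c"] by linarith
    ultimately show "Re (g w - g c) < A" by (simp add: A_def)
  qed
  also have "\<dots> \<le> 2 * A * (3/2) / \<delta>"
    unfolding dist using s A0 by (intro frac_le mult_left_mono) auto
  finally have "norm (g s - g c) \<le> 3 * A / \<delta>" by simp
  then show ?thesis
    using gc norm_triangle_sub[of "g s" "g c"] unfolding A_def t_def by linarith
qed

text \<open>The factor \<open>N\<^sup>z\<close> balances the error on the two vertical sides, \<open>exp (z\<^sup>2)\<close> suppresses the
  horizontal ones, and both equal \<open>1\<close> at \<open>z = 0\<close>.\<close>

lemma log_dirichlet_L_approx:
  assumes holg: "g holomorphic_on {s. Re s > 1/2}"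
    and expg: "\<And>s. Re s > 1/2 \<Longrightarrow> exp (g s) = dirichlet_L chi s"
    and g_eq: "\<And>s. Re s \<ge> 3/2 \<Longrightarrow> g s = (\<Sum>n. logL_term n s)"
    and \<eta>: "0 < \<eta>" "\<eta> < 1/2" and N: "N \<ge> 1"
  shows "norm (g 1 - (\<Sum>n\<le>N. logL_term n 1)) \<le>
           exp 1 * (real N powr (-\<eta>) * (1 + 3 * (ln (real q) + 16) / (1/2 - \<eta>) + primepow_head \<eta> N)
                    + real N * primepow_tail N)"
proof -
  define \<delta> where "\<delta> = 1/2 - \<eta>"
  have \<delta>: "\<delta> > 0" "\<delta> \<le> 1/2" using \<eta> by (auto simp: \<delta>_def)
  have lnq: "ln (real q) \<ge> 0" using q_gt_1 by simp
  define P where "P = (\<lambda>s. \<Sum>n\<le>N. logL_term n s)"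
  define h where "h = (\<lambda>z. (g (1 + z) - P (1 + z)) * of_nat N powr z * exp (z ^ 2))"
  \<comment> \<open>\<open>B1\<close>, \<open>B2\<close> and \<open>B3 T\<close> bound h on the
    left, right and horizontal sides of a rectangle of half-height T. Their sum bounds h on the
    whole frontier, and \<open>B3 T\<close> disappears as T grows.\<close>
  define B1 where "B1 = exp 1 * (real N powr (-\<eta>) * (1 + 3 * (ln (real q) + 16) / \<delta> + primepow_head \<eta> N))"
  define B2 where "B2 = exp 1 * (real N * primepow_tail N)"
  define B3 where "B3 = (\<lambda>T. (1 + 3 * (ln (real q) + 13 + 3 * T) / \<delta> + (real N + 1)) * real N * exp (1 - T ^ 2))"
  have head0: "primepow_head \<eta> N \<ge> 0"
    unfolding primepow_head_def by (intro sum_nonneg mult_nonneg_nonneg primepow_weight_nonneg) auto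
  have B0: "B1 \<ge> 0" "B2 \<ge> 0" "B3 T \<ge> 0" if "T \<ge> 0" for T
    using that \<delta> lnq head0 primepow_tail_nonneg[of N] unfolding B1_def B2_def B3_def
    by (auto intro!: mult_nonneg_nonneg add_nonneg_nonneg divide_nonneg_nonneg)
  have norm_h: "norm (h z) = norm (g (1 + z) - P (1 + z)) * real N powr Re z * exp ((Re z)\<^sup>2 - (Im z)\<^sup>2)" for z
    by (simp add: h_def norm_mult norm_of_nat_powr Re_power2)
  have holP: "P holomorphic_on A" for A
    unfolding P_def logL_term_def by (intro holomorphic_intros)
  have hol: "h holomorphic_on {z. Re z > -1/2}"
  proof -
    have "(g \<circ> (\<lambda>z. 1 + z)) holomorphic_on {z. Re z > -1/2}"
      by (intro holomorphic_on_compose_gen[OF _ holg] holomorphic_intros) auto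
    moreover have "(P \<circ> (\<lambda>z. 1 + z)) holomorphic_on {z. Re z > -1/2}"
      by (intro holomorphic_on_compose_gen[OF _ holP[of UNIV]] holomorphic_intros) auto
    ultimately show ?thesis
      unfolding h_def o_def using N by (intro holomorphic_intros) auto
  qed
  have normP: "norm (P s) \<le> (\<Sum>n\<le>N. primepow_weight n * real n powr (- Re s))" for s
    unfolding P_def by (intro sum_norm_le norm_logL_term_le)
  have bound: "norm (h 0) \<le> B1 + B2 + B3 T" if T: "T > 0" for T
  proof (rule maximum_modulus_frontier[of h "cbox (Complex (-\<eta>) (-T)) (Complex 1 T)"])
    let ?S = "cbox (Complex (-\<eta>) (-T)) (Complex 1 T)"
    have sub: "?S \<subseteq> {z. Re z > -1/2}" using \<eta> by (auto simp: in_cbox_complex_iff)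
    show "h holomorphic_on interior ?S"
      by (rule holomorphic_on_subset[OF hol]) (use sub interior_subset in blast)
    show "continuous_on (closure ?S) h"
      using sub by (intro holomorphic_on_imp_continuous_on holomorphic_on_subset[OF hol]) simp
    show "bounded ?S" by simp
    show "0 \<in> ?S" using \<eta> T by (auto simp: in_cbox_complex_iff)
    fix z assume "z \<in> frontier ?S"
    then have z: "z \<in> ?S" "z \<notin> box (Complex (-\<eta>) (-T)) (Complex 1 T)"
      by (auto simp: frontier_def)
    then have z1: "-\<eta> \<le> Re z" "Re z \<le> 1" "\<bar>Im z\<bar> \<le> T" and z2: "Re z = -\<eta> \<or> Re z = 1 \<or> \<bar>Im z\<bar> = T"
      by (auto simp: in_cbox_complex_iff in_box_complex_iff abs_le_iff)
    have g_le: "norm (g (1 + z)) \<le> 1 + 3 * (ln (real q) + 13 + 3 * \<bar>Im z\<bar>) / \<delta>"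
      using norm_log_dirichlet_L_le[OF holg expg g_eq \<delta>(1), of "1 + z"] z1 by (simp add: \<delta>_def)
    have gP: "norm (g (1 + z) - P (1 + z)) \<le> norm (g (1 + z)) + norm (P (1 + z))"
      by (rule norm_triangle_ineq4)
    consider "\<bar>Im z\<bar> = T" | "Re z = 1" | "Re z = -\<eta>" using z2 by blast
    then show "norm (h z) \<le> B1 + B2 + B3 T"
    proof cases
      case 1
      have "norm (P (1 + z)) \<le> (\<Sum>n\<le>N. primepow_weight n * real n powr (- Re (1 + z)))" by (rule normP)
      also have "\<dots> \<le> (\<Sum>n\<le>N. 1 * 1)"
      proof (intro sum_mono mult_mono primepow_weight_le_1)
        fix n :: nat
        show "real n powr (- Re (1 + z)) \<le> 1"
          using z1 \<eta> powr_mono[of "- Re (1 + z)" 0 "real n"] by (cases "n = 0") auto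
      qed auto
      finally have "norm (P (1 + z)) \<le> real N + 1" by simp
      then have "norm (g (1 + z) - P (1 + z)) \<le> 1 + 3 * (ln (real q) + 13 + 3 * T) / \<delta> + (real N + 1)"
        using gP g_le 1 by simp
      moreover have "real N powr Re z \<le> real N powr 1" using N z1 by (intro powr_mono) auto
      moreover have "(Re z)\<^sup>2 \<le> 1" using z1 \<eta> by (simp add: abs_square_le_1 abs_le_iff)
      then have "exp ((Re z)\<^sup>2 - (Im z)\<^sup>2) \<le> exp (1 - T ^ 2)" using 1 by (simp flip: power2_abs[of "Im z"])
      moreover have "0 \<le> 1 + 3 * (ln (real q) + 13 + 3 * T) / \<delta> + (real N + 1)"
        using \<delta> lnq T by (intro add_nonneg_nonneg divide_nonneg_nonneg) auto
      ultimately have "norm (h z) \<le> B3 T"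
        unfolding norm_h B3_def by (intro mult_mono mult_nonneg_nonneg) auto
      then show ?thesis using B0[of T] T by simp
    next
      case 2
      have Re2: "Re (1 + z) = 2" using 2 by simp
      have s: "summable (\<lambda>n. norm (logL_term n (1 + z)))" using Re2 by (intro summable_logL_term) simp
      have s': "summable (\<lambda>n. norm (logL_term (n + Suc N) (1 + z)))"
        using s by (subst summable_iff_shift)
      have "g (1 + z) - P (1 + z) = (\<Sum>n. logL_term (n + Suc N) (1 + z))"
        using g_eq[of "1 + z"] Re2 suminf_split_initial_segment[OF summable_norm_cancel[OF s], of "Suc N"]
        by (simp add: P_def lessThan_Suc_atMost)
      also have "norm \<dots> \<le> (\<Sum>n. norm (logL_term (n + Suc N) (1 + z)))" by (rule summable_norm[OF s'])
      also have "\<dots> \<le> primepow_tail N"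
        unfolding primepow_tail_def
        by (rule suminf_le[OF _ s' summable_primepow_tail]) (use norm_logL_term_le[of _ "1 + z"] Re2 in metis)
      finally have "norm (h z) \<le> primepow_tail N * real N powr 1 * exp (1 - 0)"
        unfolding norm_h 2 using primepow_tail_nonneg[of N] by (intro mult_mono) auto
      then have "norm (h z) \<le> B2" by (simp add: B2_def mult_ac)
      then show ?thesis using B0[of T] T by simp
    next
      case 3
      have "norm (P (1 + z)) \<le> primepow_head \<eta> N"
      proof -
        have "norm (P (1 + z)) \<le> (\<Sum>n\<le>N. primepow_weight n * real n powr (- Re (1 + z)))" by (rule normP)
        also have "\<dots> = primepow_head \<eta> N"
          unfolding primepow_head_def using 3 by (intro sum.mono_neutral_cong_right) (auto simp: Suc_le_eq)
        finally show ?thesis .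
      qed
      then have "norm (g (1 + z) - P (1 + z)) \<le> (1 + 3 * (ln (real q) + 13) / \<delta> + primepow_head \<eta> N) + 9 / \<delta> * \<bar>Im z\<bar>"
        using gP g_le by (simp add: add_divide_distrib algebra_simps)
      then have "norm (g (1 + z) - P (1 + z)) * exp (- (Im z)\<^sup>2)
          \<le> (1 + 3 * (ln (real q) + 13) / \<delta> + primepow_head \<eta> N) * exp (- (Im z)\<^sup>2) + 9 / \<delta> * (\<bar>Im z\<bar> * exp (- (Im z)\<^sup>2))"
        using mult_right_mono[of _ _ "exp (- (Im z)\<^sup>2)"] by (fastforce simp: algebra_simps)
      \<comment> \<open>The linear term in \<open>\<bar>Im z\<bar>\<close> is reduced to 9 /
        \<delta>, which raises 13 to 16 in the numerator.\<close>
      also have "\<dots> \<le> (1 + 3 * (ln (real q) + 13) / \<delta> + primepow_head \<eta> N) * 1 + 9 / \<delta> * 1"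
      proof (intro add_mono mult_left_mono)
        have "\<bar>Im z\<bar> \<le> 1 + (Im z)\<^sup>2"
          using zero_le_power2[of "\<bar>Im z\<bar> - 1"] zero_le_power2[of "Im z"] by (simp add: power2_diff)
        also have "\<dots> \<le> exp ((Im z)\<^sup>2)" by (rule exp_ge_add_one_self)
        finally show "\<bar>Im z\<bar> * exp (- (Im z)\<^sup>2) \<le> 1" by (simp add: exp_minus field_simps)
      qed (use \<delta> lnq head0 in \<open>auto intro!: add_nonneg_nonneg divide_nonneg_nonneg\<close>)
      also have "\<dots> = 1 + 3 * (ln (real q) + 16) / \<delta> + primepow_head \<eta> N"
        by (simp add: add_divide_distrib algebra_simps)
      finally have le: "norm (g (1 + z) - P (1 + z)) * exp (- (Im z)\<^sup>2) \<le> 1 + 3 * (ln (real q) + 16) / \<delta> + primepow_head \<eta> N" .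
      have "norm (h z) = (norm (g (1 + z) - P (1 + z)) * exp (- (Im z)\<^sup>2)) * (real N powr (-\<eta>) * exp (\<eta>\<^sup>2))"
        unfolding norm_h 3 by (simp add: exp_diff exp_minus field_simps)
      also have "\<dots> \<le> (1 + 3 * (ln (real q) + 16) / \<delta> + primepow_head \<eta> N) * (real N powr (-\<eta>) * exp 1)"
      proof (intro mult_mono le)
        show "0 \<le> 1 + 3 * (ln (real q) + 16) / \<delta> + primepow_head \<eta> N"
          using \<delta> lnq head0 by (intro add_nonneg_nonneg divide_nonneg_nonneg) auto
      qed (use \<eta> in \<open>auto simp: abs_square_le_1\<close>)
      also have "\<dots> = B1" by (simp add: B1_def mult_ac)
      finally show ?thesis using B0[of T] T by simp
    qed
  qed
  have "((\<lambda>T. B1 + B2 + B3 T) \<longlongrightarrow> B1 + B2 + 0) at_top"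
  proof (intro tendsto_intros)
    have e1: "((\<lambda>T::real. exp (1 - T ^ 2)) \<longlongrightarrow> 0) at_top" by real_asymp
    have e2: "((\<lambda>T::real. T * exp (1 - T ^ 2)) \<longlongrightarrow> 0) at_top" by real_asymp
    have eq: "B3 = (\<lambda>T. ((1 + 3 * (ln (real q) + 13) / \<delta> + (real N + 1)) * real N) * exp (1 - T ^ 2) + (9 / \<delta> * real N) * (T * exp (1 - T ^ 2)))"
      by (rule ext) (simp add: B3_def add_divide_distrib algebra_simps)
    show "(B3 \<longlongrightarrow> 0) at_top"
      unfolding eq by (rule tendsto_add_zero[OF tendsto_mult_right_zero[OF e1] tendsto_mult_right_zero[OF e2]])
  qed
  then have "norm (h 0) \<le> B1 + B2 + 0"
    by (rule tendsto_lowerbound) (auto intro: eventually_mono[OF eventually_gt_at_top[of 0]] bound)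
  moreover have "h 0 = g 1 - P 1" using N by (simp add: h_def)
  ultimately show ?thesis by (simp add: B1_def B2_def P_def \<delta>_def distrib_left)
qed

end

section \<open>The bounds for L(1)\<close>

definition approx_error :: "real \<Rightarrow> nat \<Rightarrow> nat \<Rightarrow> real" where
  "approx_error \<eta> q N = exp 1 * (real N powr (-\<eta>) * (1 + 3 * (ln (real q) + 16) / (1/2 - \<eta>) + primepow_head \<eta> N)
     + real N * primepow_tail N)"

lemma (in cubic_char) norm_dirichlet_L_1_bounds:
  assumes GRH "0 < \<eta>" "\<eta> < 1/2" "N \<ge> 1"
  shows "norm (dirichlet_L chi 1) \<le> exp (primepow_harm N + approx_error \<eta> q N)"
    and "exp ((primepow_cubes N - primepow_harm N) / 2 - approx_error \<eta> q N) \<le> norm (dirichlet_L chi 1)"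
proof -
  obtain g where g: "g holomorphic_on {s. Re s > 1/2}"
    "\<And>s. Re s > 1/2 \<Longrightarrow> exp (g s) = dirichlet_L chi s"
    "\<And>s. Re s \<ge> 3/2 \<Longrightarrow> g s = (\<Sum>n. logL_term n s)"
    using holomorphic_log_dirichlet_L[OF assms(1)] by blast
  have "norm (g 1 - (\<Sum>n\<le>N. logL_term n 1)) \<le> approx_error \<eta> q N"
    unfolding approx_error_def by (rule log_dirichlet_L_approx[OF g assms(2-4)])
  then have "\<bar>Re (g 1) - Re (\<Sum>n\<le>N. logL_term n 1)\<bar> \<le> approx_error \<eta> q N"
    using abs_Re_le_cmod[of "g 1 - (\<Sum>n\<le>N. logL_term n 1)"] by (simp del: Re_sum)
  moreover have "norm (dirichlet_L chi 1) = exp (Re (g 1))"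
    using g(2)[of 1] by (simp flip: norm_exp_eq_Re)
  moreover note Re_sum_logL_le[of N] Re_sum_logL_ge[of N]
  ultimately show "norm (dirichlet_L chi 1) \<le> exp (primepow_harm N + approx_error \<eta> q N)"
    "exp ((primepow_cubes N - primepow_harm N) / 2 - approx_error \<eta> q N) \<le> norm (dirichlet_L chi 1)"
    unfolding abs_le_iff by (simp_all only: exp_le_cancel_iff, linarith+)
qed

text \<open>Rounding up makes N at least (ln q)^a, the direction wanted for N powr
  (-\<eta>).\<close>

definition cutoff :: "real \<Rightarrow> nat \<Rightarrow> nat" where
  "cutoff a q = nat \<lceil>ln (real q) powr a\<rceil>"

lemma cutoff_at_top: "a > 0 \<Longrightarrow> filterlim (cutoff a) at_top sequentially"
proof -
  assume a: "a > 0"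
  have "eventually (\<lambda>q. Z \<le> cutoff a q) sequentially" for Z
  proof -
    have "filterlim (\<lambda>q::nat. ln (real q) powr a) at_top sequentially" using a by real_asymp
    then have "eventually (\<lambda>q. real Z \<le> ln (real q) powr a) sequentially"
      by (simp add: filterlim_at_top)
    then show ?thesis by eventually_elim (unfold cutoff_def, linarith)
  qed
  then show ?thesis by (simp add: filterlim_at_top)
qed

text \<open>The conductor enters through N^-\<eta> ln q \<le> (ln q)^(1 - a \<eta>), whence the
  condition on \<open>a * \<eta>\<close>. The other terms tend to 0 as N grows.\<close>

lemma approx_error_tendsto:
  assumes \<eta>: "0 < \<eta>" "\<eta> < 1/2" and a: "a > 0" "a * \<eta> > 1"
  shows "(\<lambda>q. approx_error \<eta> q (cutoff a q)) \<longlonglongrightarrow> 0"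
proof -
  note N = cutoff_at_top[OF a(1)]
  have "(\<lambda>N. real N * primepow_tail N) \<longlonglongrightarrow> 0"
  proof (rule tendsto_sandwich[of "\<lambda>_. 0" _ _ "\<lambda>N. 8 / ln (real N)"])
    show "(\<lambda>N. 8 / ln (real N)) \<longlonglongrightarrow> 0" by real_asymp
    show "eventually (\<lambda>N. real N * primepow_tail N \<le> 8 / ln (real N)) sequentially"
      using eventually_ge_at_top[of 2] by eventually_elim (rule primepow_tail_le)
  qed (auto intro!: always_eventually mult_nonneg_nonneg primepow_tail_nonneg)
  from filterlim_compose[OF this N] have tail: "(\<lambda>q. real (cutoff a q) * primepow_tail (cutoff a q)) \<longlonglongrightarrow> 0" .
  have head: "(\<lambda>q. real (cutoff a q) powr (-\<eta>) * primepow_head \<eta> (cutoff a q)) \<longlonglongrightarrow> 0"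
    using filterlim_compose[OF primepow_head_tendsto N, of \<eta>] \<eta> by simp
  define C where "C = (\<lambda>q. 1 + 3 * (ln (real q) + 16) / (1/2 - \<eta>))"
  have lnq: "(\<lambda>q. real (cutoff a q) powr (-\<eta>) * C q) \<longlonglongrightarrow> 0"
  proof (rule tendsto_sandwich[of "\<lambda>_. 0" _ _ "\<lambda>q. (ln (real q) powr a) powr (-\<eta>) * C q"])
    have "1/2 - \<eta> > 0" using \<eta> by simp
    then show "(\<lambda>q. (ln (real q) powr a) powr (-\<eta>) * C q) \<longlonglongrightarrow> 0"
      unfolding C_def powr_powr using a by real_asymp
    have C0: "eventually (\<lambda>q. C q \<ge> 0 \<and> ln (real q) > 0) sequentially"
      using eventually_gt_at_top[of 1]
    proof eventually_elim
      case (elim q)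
      then show ?case using \<eta> by (auto simp: C_def intro!: add_nonneg_nonneg divide_nonneg_nonneg)
    qed
    then show "eventually (\<lambda>q. 0 \<le> real (cutoff a q) powr (-\<eta>) * C q) sequentially"
      by eventually_elim simp
    from C0 show "eventually (\<lambda>q. real (cutoff a q) powr (-\<eta>) * C q \<le> (ln (real q) powr a) powr (-\<eta>) * C q) sequentially"
    proof eventually_elim
      case (elim q)
      have "ln (real q) powr a \<le> real (cutoff a q)" unfolding cutoff_def by linarith
      then show ?case using elim \<eta> by (intro mult_right_mono powr_mono2') auto
    qed
  qed auto
  have "(\<lambda>q. exp 1 * ((real (cutoff a q) powr (-\<eta>) * C q + real (cutoff a q) powr (-\<eta>) * primepow_head \<eta> (cutoff a q))
      + real (cutoff a q) * primepow_tail (cutoff a q))) \<longlonglongrightarrow> exp 1 * ((0 + 0) + 0)"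
    by (intro tendsto_intros head tail lnq)
  then show ?thesis unfolding approx_error_def C_def by (simp add: distrib_left)
qed

text \<open>The gap between a and b absorbs the rounding.\<close>

lemma ln_cutoff_le:
  assumes "0 < a" "a < b"
  shows "eventually (\<lambda>q. ln (real (cutoff a q)) \<le> b * ln (ln (real q))) sequentially"
proof -
  have "eventually (\<lambda>q::nat. ln (real q) > 1 \<and> ln (ln (real q) powr a + 1) \<le> b * ln (ln (real q))) sequentially"
    using assms by (intro eventually_conj; real_asymp)
  then show ?thesis
  proof eventually_elim
    case (elim q)
    have "ln (real (cutoff a q)) \<le> ln (ln (real q) powr a + 1)"
    proof (rule ln_mono)
      have "ln (real q) powr a > 0" using elim by simp
      then show "real (cutoff a q) \<le> ln (real q) powr a + 1" "0 < real (cutoff a q)"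
        unfolding cutoff_def by linarith+
    qed
    then show ?case using elim by simp
  qed
qed

theorem theorem1p1:
  assumes "GRH"
  shows "\<forall>\<epsilon>>0. \<exists>Q::nat. \<forall>q chi. q \<ge> Q \<and> primitive_char q chi \<and> char_order3 q chi \<longrightarrow>
           (1 / sqrt 2 - \<epsilon>) * sqrt (zeta3 / (exp euler_mascheroni * ln (ln (real q))))
              \<le> cmod (dirichlet_L chi 1) \<and>
           cmod (dirichlet_L chi 1) \<le> (2 + \<epsilon>) * exp euler_mascheroni * ln (ln (real q))"
proof (intro allI impI)
  fix \<epsilon> :: real assume \<epsilon>: "\<epsilon> > 0"
  \<comment> \<open>A single \<tau> measures all errors. Mertens' sum and
    \<open>approx_error\<close> cost \<tau> each in the upper exponent, and 2 + 2 \<tau> lies above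
    the exponent 2 + \<tau> of the cutoff.\<close>
  have "((\<lambda>\<tau>::real. exp (2 * \<tau>) * (2 + 2 * \<tau>)) \<longlongrightarrow> exp (2 * 0) * (2 + 2 * 0)) (at_right 0)"
    by (intro tendsto_intros)
  then have up: "eventually (\<lambda>\<tau>. exp (2 * \<tau>) * (2 + 2 * \<tau>) < 2 + \<epsilon>) (at_right 0)"
    using \<epsilon> by (intro order_tendstoD(2)) auto
  have "((\<lambda>\<tau>::real. exp (- 2 * \<tau>) / sqrt (2 + 2 * \<tau>)) \<longlongrightarrow> exp (- 2 * 0) / sqrt (2 + 2 * 0)) (at_right 0)"
    by (intro tendsto_intros) auto
  then have lo: "eventually (\<lambda>\<tau>. 1 / sqrt 2 - \<epsilon> < exp (- 2 * \<tau>) / sqrt (2 + 2 * \<tau>)) (at_right 0)"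
    using \<epsilon> by (intro order_tendstoD(1)) auto
  have "eventually (\<lambda>\<tau>::real. \<tau> > 0) (at_right 0)" by (rule eventually_at_right_less)
  with up lo have "eventually (\<lambda>\<tau>. \<tau> > 0 \<and> exp (2 * \<tau>) * (2 + 2 * \<tau>) < 2 + \<epsilon> \<and>
      1 / sqrt 2 - \<epsilon> < exp (- 2 * \<tau>) / sqrt (2 + 2 * \<tau>)) (at_right 0)"
    by eventually_elim auto
  then obtain \<tau> where \<tau>: "\<tau> > 0" "exp (2 * \<tau>) * (2 + 2 * \<tau>) < 2 + \<epsilon>"
      "1 / sqrt 2 - \<epsilon> < exp (- 2 * \<tau>) / sqrt (2 + 2 * \<tau>)"
    using eventually_happens'[OF trivial_limit_at_right_real] by blast
  define a where "a = 2 + \<tau>"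
  \<comment> \<open>Then \<open>a * \<eta>\<close> is (4 + 2 \<tau>) / (4 + \<tau>), just above 1,
    while \<eta> stays below 1/2.\<close>
  define \<eta> where "\<eta> = 2 / (4 + \<tau>)"
  have \<eta>: "0 < \<eta>" "\<eta> < 1/2" "a > 0" "a * \<eta> > 1" "a < 2 + 2 * \<tau>"
    using \<tau>(1) by (auto simp: \<eta>_def a_def field_simps)
  note N = cutoff_at_top[OF \<eta>(3)]
  have ev: "eventually (\<lambda>q::nat. ln (ln (real q)) > 0 \<and> cutoff a q \<ge> 3 \<and> \<bar>approx_error \<eta> q (cutoff a q)\<bar> < \<tau>
      \<and> ln (real (cutoff a q)) \<le> (2 + 2 * \<tau>) * ln (ln (real q))
      \<and> primepow_harm (cutoff a q) \<le> ln (ln (real (cutoff a q))) + euler_mascheroni + \<tau>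
      \<and> ln zeta3 - \<tau> \<le> primepow_cubes (cutoff a q)) sequentially"
  proof (intro eventually_conj)
    show "eventually (\<lambda>q::nat. ln (ln (real q)) > 0) sequentially" by real_asymp
    show "eventually (\<lambda>q. cutoff a q \<ge> 3) sequentially"
      using N by (simp add: filterlim_at_top)
    show "eventually (\<lambda>q. \<bar>approx_error \<eta> q (cutoff a q)\<bar> < \<tau>) sequentially"
      using tendstoD[OF approx_error_tendsto[OF \<eta>(1-4)] \<tau>(1)] by (simp add: dist_real_def)
    show "eventually (\<lambda>q. ln (real (cutoff a q)) \<le> (2 + 2 * \<tau>) * ln (ln (real q))) sequentially"
      by (rule ln_cutoff_le[OF \<eta>(3,5)])
    show "eventually (\<lambda>q. primepow_harm (cutoff a q) \<le> ln (ln (real (cutoff a q))) + euler_mascheroni + \<tau>) sequentially"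
      using eventually_compose_filterlim[OF primepow_harm_asymp_le[OF \<tau>(1)] N] .
    show "eventually (\<lambda>q. ln zeta3 - \<tau> \<le> primepow_cubes (cutoff a q)) sequentially"
      using eventually_compose_filterlim[OF primepow_cubes_asymp_ge[OF \<tau>(1)] N] .
  qed
  then obtain Q where Q: "\<And>q. q \<ge> Q \<Longrightarrow> ln (ln (real q)) > 0 \<and> cutoff a q \<ge> 3 \<and> \<bar>approx_error \<eta> q (cutoff a q)\<bar> < \<tau>
      \<and> ln (real (cutoff a q)) \<le> (2 + 2 * \<tau>) * ln (ln (real q))
      \<and> primepow_harm (cutoff a q) \<le> ln (ln (real (cutoff a q))) + euler_mascheroni + \<tau>
      \<and> ln zeta3 - \<tau> \<le> primepow_cubes (cutoff a q)"
    unfolding eventually_sequentially by blast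
  show "\<exists>Q::nat. \<forall>q chi. q \<ge> Q \<and> primitive_char q chi \<and> char_order3 q chi \<longrightarrow>
           (1 / sqrt 2 - \<epsilon>) * sqrt (zeta3 / (exp euler_mascheroni * ln (ln (real q))))
              \<le> cmod (dirichlet_L chi 1) \<and>
           cmod (dirichlet_L chi 1) \<le> (2 + \<epsilon>) * exp euler_mascheroni * ln (ln (real q))"
  proof (intro exI[of _ Q] allI impI)
    fix q chi assume asm: "q \<ge> Q \<and> primitive_char q chi \<and> char_order3 q chi"
    interpret cubic_char q chi by unfold_locales (use asm in blast)
    define N where "N = cutoff a q"
    define l where "l = ln (ln (real q))"
    define E where "E = approx_error \<eta> q N"
    define G where "G = exp (euler_mascheroni :: real)"
    have H: "l > 0" "N \<ge> 3" "\<bar>E\<bar> < \<tau>" "ln (real N) \<le> (2 + 2 * \<tau>) * l"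
      "primepow_harm N \<le> ln (ln (real N)) + euler_mascheroni + \<tau>" "ln zeta3 - \<tau> \<le> primepow_cubes N"
      using Q[of q] asm by (auto simp: N_def l_def E_def)
    have lnN: "ln (real N) > 0" using H by simp
    have G: "G > 0" by (simp add: G_def)
    note bounds = norm_dirichlet_L_1_bounds[OF assms \<eta>(1,2), of N, folded E_def]
    have "norm (dirichlet_L chi 1) \<le> exp (primepow_harm N + E)" using bounds(1) H by simp
    also have "\<dots> \<le> exp (ln (ln (real N)) + euler_mascheroni + 2 * \<tau>)" using H by simp
    also have "\<dots> = ln (real N) * G * exp (2 * \<tau>)" using lnN by (simp add: exp_add G_def)
    also have "\<dots> \<le> ((2 + 2 * \<tau>) * l) * G * exp (2 * \<tau>)"
      using H G by (intro mult_right_mono) auto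
    also have "\<dots> = (exp (2 * \<tau>) * (2 + 2 * \<tau>)) * G * l" by (simp add: mult_ac)
    also have "\<dots> \<le> (2 + \<epsilon>) * G * l"
      using \<tau>(2) H G by (intro mult_right_mono) auto
    finally have upper: "norm (dirichlet_L chi 1) \<le> (2 + \<epsilon>) * G * l" .
    have "(1 / sqrt 2 - \<epsilon>) * sqrt (zeta3 / (G * l)) \<le> exp (- 2 * \<tau>) / sqrt (2 + 2 * \<tau>) * sqrt (zeta3 / (G * l))"
      using \<tau>(3) zeta3_eq(2) G H by (intro mult_right_mono) auto
    also have "\<dots> = exp (- 2 * \<tau>) * sqrt (zeta3 / (G * ((2 + 2 * \<tau>) * l)))"
      by (simp add: real_sqrt_divide real_sqrt_mult mult_ac)
    also have "\<dots> \<le> exp (- 2 * \<tau>) * sqrt (zeta3 / (G * ln (real N)))"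
      using H G lnN zeta3_eq(2) \<tau>(1)
      by (intro mult_left_mono real_sqrt_le_mono divide_left_mono mult_pos_pos) auto
    \<comment> \<open>Written as an exponential so that the two sides can be compared by their
      exponents.\<close>
    also have "sqrt (zeta3 / (G * ln (real N))) = exp ((ln zeta3 - (ln (ln (real N)) + euler_mascheroni)) / 2)"
    proof -
      have "zeta3 / (G * ln (real N)) = exp (ln zeta3 - (ln (ln (real N)) + euler_mascheroni))"
        using zeta3_eq(2) lnN by (simp add: exp_diff exp_add G_def mult.commute)
      also have "\<dots> = exp ((ln zeta3 - (ln (ln (real N)) + euler_mascheroni)) / 2) ^ 2"
        by (simp add: power2_eq_square flip: exp_add)
      finally show ?thesis by simp
    qed
    also have "exp (- 2 * \<tau>) * \<dots> = exp ((ln zeta3 - (ln (ln (real N)) + euler_mascheroni)) / 2 - 2 * \<tau>)"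
      unfolding exp_add[symmetric] by (rule arg_cong[of _ _ exp]) simp
    also have "\<dots> \<le> exp ((primepow_cubes N - primepow_harm N) / 2 - E)"
    proof (subst exp_le_cancel_iff)
      \<comment> \<open>The cubes and Mertens' sum lose \<tau> / 2 each after halving; the remaining
        \<tau> pays for E.\<close>
      have "(ln zeta3 - \<tau> - (ln (ln (real N)) + euler_mascheroni + \<tau>)) / 2 \<le> (primepow_cubes N - primepow_harm N) / 2"
        using H(5,6) by (intro divide_right_mono diff_mono) auto
      then show "(ln zeta3 - (ln (ln (real N)) + euler_mascheroni)) / 2 - 2 * \<tau> \<le> (primepow_cubes N - primepow_harm N) / 2 - E"
        using H(3) by (simp add: field_simps)
    qed
    also have "\<dots> \<le> norm (dirichlet_L chi 1)" using bounds(2) H by simp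
    finally have lower: "(1 / sqrt 2 - \<epsilon>) * sqrt (zeta3 / (G * l)) \<le> norm (dirichlet_L chi 1)" .
    from upper lower show "(1 / sqrt 2 - \<epsilon>) * sqrt (zeta3 / (exp euler_mascheroni * ln (ln (real q))))
              \<le> cmod (dirichlet_L chi 1) \<and>
           cmod (dirichlet_L chi 1) \<le> (2 + \<epsilon>) * exp euler_mascheroni * ln (ln (real q))"
      unfolding G_def l_def by blast
  qed
qed

end
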